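(* Let $A$ be a centrosymmetric $\{0,1,-1\}$-matrix with an even number of rows and an even number of columns, and let $G$ be the cell graph of $A$. Consider the statements: (i) $G$ is a forest (has no cycles); (ii) the map $\mathrm{rc}$ on $G$ sends every connected component of $G$ onto a different component; (iii) $\liminf_{n\to\infty}|\mathrm{Geom}(A)^{rc}_{2n}|^{1/n}\ge\lim_{n\to\infty}|\mathrm{Geom}(A)_n|^{1/n}$. Then (i) implies (ii), and (ii) implies (iii).
   Context: A permutation of size $n$ is a bijection of $[n]$. For $\pi$ of size $n$, $\mathrm{rc}(\pi)(i)=n+1-\pi(n+1-i)$; $\pi$ is centrosymmetric if $\mathrm{rc}(\pi)=\pi$. For a class $\mathcal{C}$, $\mathcal{C}_n$ is its set of size-$n$ elements and $\mathcal{C}^{rc}_n$ the set of centrosymmetric elements of $\mathcal{C}_n$. Geometric grid classes: let $A$ be an $r\times c$ matrix with entries in $\{0,1,-1\}$ (row 1 at the top). Its standard figure is the subset of $[0,c]\times[0,r]$ obtained by placing in the unit square of cell $(i,j)$ (the square $[j-1,j]\times[r-i,r-i+1]$) the diagonal segment of slope $1$ if $A_{i,j}=1$, of slope $-1$ if $A_{i,j}=-1$, and nothing if $A_{i,j}=0$. A set of $n$ points on the figure, no two sharing an $x$- or $y$-coordinate, determines the size-$n$ permutation with the same relative order; $\mathrm{Geom}(A)$ is the set of all permutations so obtained (a permutation class; $\lim_n|\mathrm{Geom}(A)_n|^{1/n}$ is known to exist). $A$ is centrosymmetric if $A_{i,j}=A_{r+1-i,\,c+1-j}$ for all $i,j$.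 The cell graph of $A$ has the non-zero cells of $A$ as vertices, two cells being adjacent if they lie in the same row or same column with no non-zero cell between them in that row or column. When $A$ is centrosymmetric, the map $\mathrm{rc}:(i,j)\mapsto(r+1-i,c+1-j)$ on cells is an automorphism of the cell graph. *)

theory Defs
  imports
    "Jordan_Normal_Form.Matrix"
    "HOL-Combinatorics.Permutations"
    "HOL-Library.Extended_Real"
begin

section \<open>Permutations\<close>

text \<open>
  A permutation of size \<open>n\<close> is a function \<open>p\<close> with \<open>p permutes {1..n}\<close>; in particular it is
  the identity outside \<open>{1..n}\<close>, so that distinct functions are distinct permutations.
\<close>

definition rc_perm :: "nat \<Rightarrow> (nat \<Rightarrow> nat) \<Rightarrow> nat \<Rightarrow> nat" where
  "rc_perm n p = (\<lambda>i. if i \<in> {1..n} then n + 1 - p (n + 1 - i) else i)"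

definition centrosymmetric_perm :: "nat \<Rightarrow> (nat \<Rightarrow> nat) \<Rightarrow> bool" where
  "centrosymmetric_perm n p \<longleftrightarrow> rc_perm n p = p"

section \<open>Geometric grid classes\<close>

text \<open>
  Matrices are indexed from \<open>0\<close>, with row \<open>0\<close> at the top, so the cell \<open>(i, j)\<close> of an
  \<open>r\<close> by \<open>c\<close> matrix is the unit square \<open>[j, j + 1] \<times> [r - i - 1, r - i]\<close>.
\<close>

definition cell_segment :: "int mat \<Rightarrow> nat \<Rightarrow> nat \<Rightarrow> (real \<times> real) set" where
  "cell_segment A i j =
    (if A $$ (i, j) = 1 then
       {(real j + t, real (dim_row A) - real i - 1 + t) | t. 0 \<le> t \<and> t \<le> 1}
     else if A $$ (i, j) = - 1 then
       {(real j + t, real (dim_row A) - real i - t) | t. 0 \<le> t \<and> t \<le> 1}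
     else {})"

definition standard_figure :: "int mat \<Rightarrow> (real \<times> real) set" where
  "standard_figure A = (\<Union>i<dim_row A. \<Union>j<dim_col A. cell_segment A i j)"

definition same_relative_order :: "nat \<Rightarrow> (nat \<Rightarrow> nat) \<Rightarrow> (real \<times> real) set \<Rightarrow> bool" where
  "same_relative_order n p S \<longleftrightarrow>
    (\<exists>f. bij_betw f {1..n} S \<and>
      (\<forall>i\<in>{1..n}. \<forall>j\<in>{1..n}.
        (fst (f i) < fst (f j) \<longleftrightarrow> i < j) \<and> (snd (f i) < snd (f j) \<longleftrightarrow> p i < p j)))"

definition Geom :: "int mat \<Rightarrow> nat \<Rightarrow> (nat \<Rightarrow> nat) set" where
  "Geom A n = {p. p permutes {1..n} \<and>
    (\<exists>S. S \<subseteq> standard_figure A \<and> finite S \<and> card S = n \<and> inj_on fst S \<and> inj_on snd S \<and>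
      same_relative_order n p S)}"

definition Geom_rc :: "int mat \<Rightarrow> nat \<Rightarrow> (nat \<Rightarrow> nat) set" where
  "Geom_rc A n = {p \<in> Geom A n. centrosymmetric_perm n p}"

definition centrosymmetric_mat :: "int mat \<Rightarrow> bool" where
  "centrosymmetric_mat A \<longleftrightarrow>
    (\<forall>i<dim_row A. \<forall>j<dim_col A. A $$ (i, j) = A $$ (dim_row A - 1 - i, dim_col A - 1 - j))"

section \<open>The cell graph\<close>

definition cells :: "int mat \<Rightarrow> (nat \<times> nat) set" where
  "cells A = {(i, j). i < dim_row A \<and> j < dim_col A \<and> A $$ (i, j) \<noteq> 0}"

definition cell_edges :: "int mat \<Rightarrow> ((nat \<times> nat) \<times> (nat \<times> nat)) set" where
  "cell_edges A = {((i, j), (k, l)). (i, j) \<in> cells A \<and> (k, l) \<in> cells A \<and> (i, j) \<noteq> (k, l) \<and>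
    (i = k \<and> (\<forall>m. min j l < m \<and> m < max j l \<longrightarrow> (i, m) \<notin> cells A) \<or>
     j = l \<and> (\<forall>m. min i k < m \<and> m < max i k \<longrightarrow> (m, j) \<notin> cells A))}"

definition rc_cell :: "int mat \<Rightarrow> nat \<times> nat \<Rightarrow> nat \<times> nat" where
  "rc_cell A = (\<lambda>(i, j). (dim_row A - 1 - i, dim_col A - 1 - j))"

text \<open>
  A simple graph is a vertex set \<open>V\<close> with a symmetric irreflexive relation \<open>E \<subseteq> V \<times> V\<close>. The
  length bound excludes walking back and forth along a single edge, which a directed notion of
  cycle (and hence the directed notion of forest) would count.
\<close>

definition is_cycle :: "('a \<times> 'a) set \<Rightarrow> 'a list \<Rightarrow> bool" where
  "is_cycle E xs \<longleftrightarrow> 3 \<le> length xs \<and> distinct xs \<and>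
    (\<forall>k<length xs. (xs ! k, xs ! (Suc k mod length xs)) \<in> E)"

definition is_forest :: "('a \<times> 'a) set \<Rightarrow> bool" where
  "is_forest E \<longleftrightarrow> (\<nexists>xs. is_cycle E xs)"

definition components :: "'a set \<Rightarrow> ('a \<times> 'a) set \<Rightarrow> 'a set set" where
  "components V E = V // (E\<^sup>* \<inter> V \<times> V)"

definition rc_moves_components :: "int mat \<Rightarrow> bool" where
  "rc_moves_components A \<longleftrightarrow>
    (\<forall>C \<in> components (cells A) (cell_edges A).
      rc_cell A ` C \<in> components (cells A) (cell_edges A) \<and> rc_cell A ` C \<noteq> C)"

end

theory Submission
  imports Defs
begin

text \<open>
  (i) \<open>\<Longrightarrow>\<close> (ii): since both dimensions are even, no cell is equal or adjacent to its own rotation. Take a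
  cell \<open>v\<close> and a shortest walk from \<open>v\<close> to its rotation, with \<open>v\<close> chosen to make the length minimal.
  By minimality this walk and its rotation meet only at their ends, so together they form a cycle.

  (ii) \<open>\<Longrightarrow>\<close> (iii): up to polynomial factors one may count point sets together with the numbers of their
  points in each half-unit strip. All cells of a row or a column lie in one component, so (ii) splits
  the figure into a half \<open>H\<close> and its rotation, which share no row and no column. A point set on the figure
  is determined by its two parts, so \<open>g n \<le> (\<Sum>k\<le>n. h k * h (n - k))\<close> for the counts \<open>g\<close> on the
  figure and \<open>h\<close> on \<open>H\<close>. The figure is mapped into itself both by contracting and by expanding the
  distance of the coordinates to the nearest integers. Contracting one point set to distances below
  \<open>1 / 4\<close> and expanding another to distances above \<open>1 / 4\<close>, their union determines the two sets up
  to the strip counts, so \<open>h k * h m\<close> is at most a polynomial in \<open>m\<close> times \<open>h (k + m)\<close>. Hence \<open>g n\<close> is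
  at most a polynomial times \<open>h n\<close>, and a point set on \<open>H\<close> together with its rotation is a
  centrosymmetric one of twice the size. The same near-supermultiplicativity for \<open>g\<close>, with a loss
  depending only on \<open>m\<close>, gives the existence of the limit.
\<close>

section \<open>Patterns of point sets\<close>

text \<open>The weak inequality makes ranks start at 1, so that they are positions in
  \<open>{1..card S}\<close>.\<close>

definition rank :: "('a \<Rightarrow> real) \<Rightarrow> 'a set \<Rightarrow> 'a \<Rightarrow> nat" where
  "rank k S a = card {b \<in> S. k b \<le> k a}"

lemma rank_less_iff:
  assumes "finite S" "a \<in> S" "b \<in> S"
  shows "rank k S a < rank k S b \<longleftrightarrow> k a < k b"
proof
  assume "k a < k b"
  then have "{c \<in> S. k c \<le> k a} \<subset> {c \<in> S. k c \<le> k b}"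
    using assms by force
  then show "rank k S a < rank k S b"
    unfolding rank_def using assms by (intro psubset_card_mono) auto
next
  assume *: "rank k S a < rank k S b"
  show "k a < k b"
  proof (rule ccontr)
    assume "\<not> k a < k b"
    then have "{c \<in> S. k c \<le> k b} \<subseteq> {c \<in> S. k c \<le> k a}"
      by auto
    then have "rank k S b \<le> rank k S a"
      unfolding rank_def using assms by (intro card_mono) auto
    with * show False by simp
  qed
qed

lemma bij_betw_rank:
  assumes "finite S" "inj_on k S"
  shows "bij_betw (rank k S) S {1..card S}"
proof -
  have inj: "inj_on (rank k S) S"
  proof (rule inj_onI)
    fix a b assume ab: "a \<in> S" "b \<in> S" "rank k S a = rank k S b"
    then have "k a = k b"
      using rank_less_iff[OF assms(1), of a b k] rank_less_iff[OF assms(1), of b a k] by force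
    then show "a = b" using assms(2) ab by (auto dest: inj_onD)
  qed
  have "rank k S a \<in> {1..card S}" if "a \<in> S" for a
  proof -
    have "{b \<in> S. k b \<le> k a} \<noteq> {}" using that by auto
    then show ?thesis
      unfolding rank_def using assms
      by (auto simp: Suc_le_eq card_gt_0_iff intro!: card_mono)
  qed
  then have "rank k S ` S = {1..card S}"
    using card_image[OF inj] by (intro card_subset_eq) auto
  with inj show ?thesis by (simp add: bij_betw_def)
qed

text \<open>Ranks depend only on the order of the keys: the bijection carries each initial segment
  of \<open>S\<close> onto one of \<open>T\<close>.\<close>

lemma rank_bij_betw:
  assumes "bij_betw \<phi> S T" "a \<in> S"
    and "\<And>a b. a \<in> S \<Longrightarrow> b \<in> S \<Longrightarrow> k' (\<phi> a) < k' (\<phi> b) \<longleftrightarrow> k a < k b"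
  shows "rank k' T (\<phi> a) = rank k S a"
proof -
  have "{c \<in> T. k' c \<le> k' (\<phi> a)} = \<phi> ` {b \<in> S. k b \<le> k a}"
    using assms by (fastforce simp: bij_betw_def not_less[symmetric])
  moreover have "inj_on \<phi> {b \<in> S. k b \<le> k a}"
    using assms(1) by (auto simp: bij_betw_def intro: inj_on_subset)
  ultimately show ?thesis
    by (simp add: rank_def card_image)
qed

definition general_position :: "(real \<times> real) set \<Rightarrow> bool" where
  "general_position S \<longleftrightarrow> finite S \<and> inj_on fst S \<and> inj_on snd S"

lemma bij_betw_rank_general_position:
  assumes "general_position S"
  shows "bij_betw (rank fst S) S {1..card S}" "bij_betw (rank snd S) S {1..card S}"
  using assms bij_betw_rank unfolding general_position_def by blast+

text \<open>An explicit function in place of the relation \<open>same_relative_order\<close>; the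
  identity outside the positions makes it a permutation in the sense of
  \<open>permutes\<close>.\<close>

definition pattern :: "(real \<times> real) set \<Rightarrow> nat \<Rightarrow> nat" where
  "pattern S i =
    (if i \<in> {1..card S} then rank snd S (inv_into S (rank fst S) i) else i)"

lemma pattern_rank:
  assumes "general_position S" "a \<in> S"
  shows "pattern S (rank fst S a) = rank snd S a"
proof -
  show ?thesis
    using assms bij_betw_rank_general_position(1)[OF assms(1)] by (auto simp: pattern_def bij_betw_def)
qed

lemma pattern_permutes:
  assumes "general_position S"
  shows "pattern S permutes {1..card S}"
proof (rule bij_imp_permutes)
  have x: "bij_betw (rank fst S) S {1..card S}" and y: "bij_betw (rank snd S) S {1..card S}"
    using bij_betw_rank_general_position[OF assms] by auto
  have "bij_betw (rank snd S \<circ> inv_into S (rank fst S)) {1..card S} {1..card S}"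
    using bij_betw_inv_into[OF x] y by (rule bij_betw_trans)
  then show "bij_betw (pattern S) {1..card S} {1..card S}"
    by (rule iffD1[OF bij_betw_cong, rotated]) (simp add: pattern_def)
qed (auto simp: pattern_def)

text \<open>Any witness \<open>f\<close> of the relation is forced: comparing \<open>S\<close> with
  the index set, whose ranks are known, shows that \<open>f i\<close> has x-rank \<open>i\<close>
  and y-rank \<open>p i\<close>. Conversely, the inverse of the x-rank is a witness.\<close>

lemma same_relative_order_iff:
  assumes S: "general_position S" and p: "p permutes {1..card S}"
  shows "same_relative_order (card S) p S \<longleftrightarrow> p = pattern S"
proof
  let ?n = "card S"
  have x: "bij_betw (rank fst S) S {1..?n}" and y: "bij_betw (rank snd S) S {1..?n}"
    and fin: "finite S"
    using bij_betw_rank_general_position[OF S] S by (simp_all add: general_position_def)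
  {
    assume "p = pattern S"
    have "bij_betw (inv_into S (rank fst S)) {1..?n} S"
      using x by (rule bij_betw_inv_into)
    moreover have "(fst (inv_into S (rank fst S) i) < fst (inv_into S (rank fst S) j) \<longleftrightarrow> i < j) \<and>
        (snd (inv_into S (rank fst S) i) < snd (inv_into S (rank fst S) j) \<longleftrightarrow> p i < p j)"
      if "i \<in> {1..?n}" "j \<in> {1..?n}" for i j
    proof -
      have "i \<in> rank fst S ` S" "j \<in> rank fst S ` S"
        using that x by (auto simp: bij_betw_def)
      then obtain a b where ab: "a \<in> S" "i = rank fst S a" "b \<in> S" "j = rank fst S b"
        by blast
      then have "inv_into S (rank fst S) i = a" "inv_into S (rank fst S) j = b"
        using x by (auto simp: bij_betw_def)
      then show ?thesis
        using ab S fin \<open>p = pattern S\<close> by (simp add: pattern_rank rank_less_iff)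
    qed
    ultimately show "same_relative_order ?n p S"
      unfolding same_relative_order_def by blast
  }
  {
    assume "same_relative_order ?n p S"
    then obtain f where f: "bij_betw f {1..?n} S"
      and o: "\<And>i j. i \<in> {1..?n} \<Longrightarrow> j \<in> {1..?n} \<Longrightarrow>
        (fst (f i) < fst (f j) \<longleftrightarrow> i < j) \<and> (snd (f i) < snd (f j) \<longleftrightarrow> p i < p j)"
      unfolding same_relative_order_def by blast
    show "p = pattern S"
    proof
      fix i
      show "p i = pattern S i"
      proof (cases "i \<in> {1..?n}")
        case True
        have "rank fst S (f i) = rank real {1..?n} i"
          using f True by (rule rank_bij_betw) (use o in auto)
        also have "\<dots> = i"
        proof -
          have "{b \<in> {1..?n}. real b \<le> real i} = {1..i}" using True by auto
          then show ?thesis by (simp add: rank_def)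
        qed
        finally have 1: "rank fst S (f i) = i" .
        have "rank snd S (f i) = rank (\<lambda>i. real (p i)) {1..?n} i"
          using f True by (rule rank_bij_betw) (use o in auto)
        also have "\<dots> = rank real {1..?n} (p i)"
          using permutes_imp_bij[OF p] True by (rule rank_bij_betw[symmetric]) auto
        also have "\<dots> = p i"
        proof -
          have "p i \<in> {1..?n}" using permutes_in_image[OF p] True by blast
          then have "{b \<in> {1..?n}. real b \<le> real (p i)} = {1..p i}" by auto
          then show ?thesis by (simp add: rank_def)
        qed
        finally have 2: "rank snd S (f i) = p i" .
        have "f i \<in> S" using f True by (auto simp: bij_betw_def)
        from pattern_rank[OF S this] 1 2 show ?thesis by simp
      next
        case False
        then show ?thesis using p by (auto simp: pattern_def permutes_def)
      qed
    qed
  }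
qed

section \<open>Order isomorphisms between point sets\<close>

definition order_iso :: "(real \<times> real \<Rightarrow> real \<times> real) \<Rightarrow> (real \<times> real) set \<Rightarrow> (real \<times> real) set \<Rightarrow> bool" where
  "order_iso \<phi> S T \<longleftrightarrow> bij_betw \<phi> S T \<and>
    (\<forall>a\<in>S. \<forall>b\<in>S. (fst (\<phi> a) < fst (\<phi> b) \<longleftrightarrow> fst a < fst b) \<and> (snd (\<phi> a) < snd (\<phi> b) \<longleftrightarrow> snd a < snd b))"

lemma order_iso_imp_pattern_eq:
  assumes S: "general_position S" and T: "general_position T" and iso: "order_iso \<phi> S T"
  shows "pattern S = pattern T"
proof
  fix i
  have bij: "bij_betw \<phi> S T" using iso by (simp add: order_iso_def)
  have card: "card S = card T" using bij by (rule bij_betw_same_card)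
  show "pattern S i = pattern T i"
  proof (cases "i \<in> {1..card S}")
    case True
    moreover have "bij_betw (rank fst S) S {1..card S}"
      using S by (rule bij_betw_rank_general_position)
    ultimately obtain a where a: "a \<in> S" "i = rank fst S a"
      by (metis bij_betw_imp_surj_on imageE)
    have "rank fst T (\<phi> a) = rank fst S a" "rank snd T (\<phi> a) = rank snd S a"
      using iso a by (auto intro!: rank_bij_betw[OF bij] simp: order_iso_def)
    moreover have "\<phi> a \<in> T" using bij a by (auto simp: bij_betw_def)
    ultimately show ?thesis
      using pattern_rank[OF S a(1)] pattern_rank[OF T] a by metis
  next
    case False
    then show ?thesis using card by (simp only: pattern_def if_False)
  qed
qed

text \<open>Matching points of equal x-rank preserves the x-order, and equal patterns then force
  equal y-ranks.\<close>

lemma pattern_eq_imp_order_iso: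
  assumes S: "general_position S" and T: "general_position T"
    and card: "card S = card T" and pat: "pattern S = pattern T"
  obtains \<phi> where "order_iso \<phi> S T"
proof
  let ?\<phi> = "inv_into T (rank fst T) \<circ> rank fst S"
  have x: "bij_betw (rank fst S) S {1..card T}"
    using bij_betw_rank_general_position(1)[OF S] card by simp
  have x': "bij_betw (rank fst T) T {1..card T}"
    using T by (rule bij_betw_rank_general_position)
  have bij: "bij_betw ?\<phi> S T"
    using x bij_betw_inv_into[OF x'] by (rule bij_betw_trans)
  have in_T: "?\<phi> a \<in> T" if "a \<in> S" for a
    using bij that by (auto simp: bij_betw_def)
  have rx: "rank fst T (?\<phi> a) = rank fst S a" if "a \<in> S" for a
    using bij_betw_inv_into_right[OF x' bij_betw_apply[OF x that]] by simp
  have ry: "rank snd T (?\<phi> a) = rank snd S a" if "a \<in> S" for a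
    using pattern_rank[OF S that] pattern_rank[OF T in_T[OF that]] rx[OF that] pat by simp
  have fin: "finite S" "finite T" using S T by (auto simp: general_position_def)
  show "order_iso ?\<phi> S T"
    unfolding order_iso_def
    using bij rx ry rank_less_iff[OF fin(1)] rank_less_iff[OF fin(2) in_T in_T] by metis
qed

text \<open>Labels increase weakly with the key, so the points with label at most \<open>z\<close>
  form an initial segment whose length is read off the label multiset. An order isomorphism matches
  initial segments of equal length. In this way strip counts alone fix the strip of every
  point.\<close>

lemma order_iso_label:
  fixes lab :: "real \<Rightarrow> int"
  assumes fin: "finite S" and bij: "bij_betw \<phi> S T" and a: "a \<in> S"
    and o: "\<And>a b. a \<in> S \<Longrightarrow> b \<in> S \<Longrightarrow> k (\<phi> a) < k (\<phi> b) \<longleftrightarrow> k a < k b"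
    and mono: "mono lab"
    and eq: "image_mset (\<lambda>a. lab (k a)) (mset_set S) = image_mset (\<lambda>a. lab (k a)) (mset_set T)"
  shows "lab (k (\<phi> a)) = lab (k a)"
proof -
  have finT: "finite T" using fin bij by (simp add: bij_betw_finite)
  have cnt: "card {b \<in> S. lab (k b) \<le> z} = card {b \<in> T. lab (k b) \<le> z}" for z
  proof -
    have "size (filter_mset (\<lambda>l. l \<le> z) (image_mset (\<lambda>a. lab (k a)) (mset_set U))) =
        card {b \<in> U. lab (k b) \<le> z}" if "finite U" for U
      using that by (simp add: filter_mset_image_mset o_def)
    from this[OF fin] this[OF finT] eq show ?thesis by simp
  qed
  have inj: "inj_on \<phi> S" and im: "\<phi> ` S = T" using bij by (auto simp: bij_betw_def)
  have lt: "x < y" if "lab x < lab y" for x y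
    using monoD[OF mono, of y x] that by force
  show ?thesis
  proof (rule antisym; rule ccontr)
    assume "\<not> lab (k (\<phi> a)) \<le> lab (k a)"
    then have *: "lab (k a) < lab (k (\<phi> a))" by simp
    \<comment> \<open>If the label rises, each point of \<open>T\<close> with label at most that of
      \<open>a\<close> comes from a point strictly before \<open>a\<close>, which makes one point
      too few.\<close>
    have "{b \<in> T. lab (k b) \<le> lab (k a)} \<subseteq> \<phi> ` ({b \<in> S. lab (k b) \<le> lab (k a)} - {a})"
    proof
      fix c assume c: "c \<in> {b \<in> T. lab (k b) \<le> lab (k a)}"
      then obtain b where b: "b \<in> S" "c = \<phi> b" using im by blast
      have "k (\<phi> b) < k (\<phi> a)" using * c b by (intro lt) auto
      then have "k b < k a" using o a b by auto
      then have "b \<in> {b \<in> S. lab (k b) \<le> lab (k a)} - {a}"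
        using b monoD[OF mono, of "k b" "k a"] by auto
      then show "c \<in> \<phi> ` ({b \<in> S. lab (k b) \<le> lab (k a)} - {a})" using b by blast
    qed
    then have "card {b \<in> T. lab (k b) \<le> lab (k a)} \<le> card (\<phi> ` ({b \<in> S. lab (k b) \<le> lab (k a)} - {a}))"
      using fin by (intro card_mono) auto
    also have "\<dots> \<le> card ({b \<in> S. lab (k b) \<le> lab (k a)} - {a})"
      using fin by (intro card_image_le) auto
    also have "\<dots> < card {b \<in> S. lab (k b) \<le> lab (k a)}"
      using fin a by (intro psubset_card_mono) auto
    finally show False by (simp add: cnt)
  next
    assume *: "\<not> lab (k a) \<le> lab (k (\<phi> a))"
    let ?z = "lab (k (\<phi> a))"
    \<comment> \<open>If the label falls, the points of \<open>S\<close> with label at most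
      \<open>?z\<close> lie before \<open>a\<close>; their images miss \<open>\<phi> a\<close>,
      which has that label, so the counts disagree again.\<close>
    have "\<phi> ` {b \<in> S. lab (k b) \<le> ?z} \<subseteq> {b \<in> T. lab (k b) \<le> ?z} - {\<phi> a}"
    proof clarify
      fix b assume b: "b \<in> S" "lab (k b) \<le> ?z"
      then have "k b < k a" using * by (intro lt) auto
      then have "k (\<phi> b) < k (\<phi> a)" using o a b by auto
      then show "\<phi> b \<in> {b \<in> T. lab (k b) \<le> ?z} - {\<phi> a}"
        using im b monoD[OF mono, of "k (\<phi> b)" "k (\<phi> a)"] by auto
    qed
    then have "card (\<phi> ` {b \<in> S. lab (k b) \<le> ?z}) \<le> card ({b \<in> T. lab (k b) \<le> ?z} - {\<phi> a})"
      using finT by (intro card_mono) auto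
    also have "\<dots> < card {b \<in> T. lab (k b) \<le> ?z}"
      using finT a im by (intro psubset_card_mono) auto
    also have "card (\<phi> ` {b \<in> S. lab (k b) \<le> ?z}) = card {b \<in> S. lab (k b) \<le> ?z}"
      by (intro card_image inj_on_subset[OF inj]) auto
    finally show False by (simp add: cnt)
  qed
qed

text \<open>\<open>d\<close> need not be a function of \<open>f x\<close>: the data may depend on
  the representing point set, of which one is picked for each value of \<open>d\<close>.\<close>

lemma card_image_le_if_determined:
  assumes "finite B" "\<And>x. x \<in> X \<Longrightarrow> d x \<in> B"
    and "\<And>x y. x \<in> X \<Longrightarrow> y \<in> X \<Longrightarrow> d x = d y \<Longrightarrow> f x = f y"
  shows "card (f ` X) \<le> card B"
proof -
  let ?g = "\<lambda>z. f (SOME x. x \<in> X \<and> d x = z)"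
  have g: "?g (d x) = f x" if "x \<in> X" for x
  proof -
    have "(SOME y. y \<in> X \<and> d y = d x) \<in> X \<and> d (SOME y. y \<in> X \<and> d y = d x) = d x"
      using that by (intro someI[of "\<lambda>y. y \<in> X \<and> d y = d x" x]) auto
    then show ?thesis using assms(3) that by blast
  qed
  have "f ` X \<subseteq> ?g ` B"
  proof (rule image_subsetI)
    fix x assume "x \<in> X"
    then show "f x \<in> ?g ` B" by (intro image_eqI[where x = "d x"] g[symmetric] assms(2))
  qed
  then show ?thesis
    using assms(1) by (meson surj_card_le)
qed

lemma order_iso_restrict:
  assumes "order_iso \<phi> S T" "\<And>a. a \<in> S \<Longrightarrow> Q (\<phi> a) \<longleftrightarrow> P a"
  shows "order_iso \<phi> {a \<in> S. P a} {b \<in> T. Q b}"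
proof -
  have "inj_on \<phi> {a \<in> S. P a}" "\<phi> ` {a \<in> S. P a} = {b \<in> T. Q b}"
    using assms by (auto simp: order_iso_def bij_betw_def inj_on_def)
  then show ?thesis
    using assms(1) by (simp add: order_iso_def bij_betw_def)
qed

section \<open>Point sets with strip counts\<close>

text \<open>Strips have width one half because the distance to the nearest integer is monotone on
  each of them; the multiset records only how many points each strip holds.\<close>

definition xstrips :: "(real \<times> real) set \<Rightarrow> int multiset" where
  "xstrips S = image_mset (\<lambda>p. \<lfloor>2 * fst p\<rfloor>) (mset_set S)"

definition ystrips :: "(real \<times> real) set \<Rightarrow> int multiset" where
  "ystrips S = image_mset (\<lambda>p. \<lfloor>2 * snd p\<rfloor>) (mset_set S)"

text \<open>Stands in for a pattern together with the grid lines: pattern and strip counts determine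
  the strip of every point by \<open>order_iso_label\<close>, while there are only polynomially many
  counts.\<close>

definition code :: "(real \<times> real) set \<Rightarrow> (nat \<Rightarrow> nat) \<times> int multiset \<times> int multiset" where
  "code S = (pattern S, xstrips S, ystrips S)"

text \<open>Multiples of \<open>1 / 2\<close> are avoided so that reflections map strips to
  strips.\<close>

definition off_grid :: "real \<times> real \<Rightarrow> bool" where
  "off_grid p \<longleftrightarrow> 2 * fst p \<notin> \<int> \<and> 2 * snd p \<notin> \<int>"

definition config :: "(real \<times> real) set \<Rightarrow> nat \<Rightarrow> (real \<times> real) set set" where
  "config F n = {S. S \<subseteq> F \<and> general_position S \<and> card S = n \<and> (\<forall>p\<in>S. off_grid p)}"

lemma configD:
  assumes "S \<in> config F n"
  shows "S \<subseteq> F" "general_position S" "card S = n" "finite S" "inj_on fst S" "inj_on snd S"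
    "\<And>p. p \<in> S \<Longrightarrow> off_grid p"
  using assms by (auto simp: config_def general_position_def)

lemma strips_Un:
  assumes "finite S" "finite T" "S \<inter> T = {}"
  shows "xstrips (S \<union> T) = xstrips S + xstrips T" "ystrips (S \<union> T) = ystrips S + ystrips T"
  using assms by (simp_all add: xstrips_def ystrips_def mset_set_Union)

definition strip_multisets :: "nat \<Rightarrow> nat \<Rightarrow> int multiset set" where
  "strip_multisets N n = {M. set_mset M \<subseteq> {0..2 * int N} \<and> size M = n}"

text \<open>A multiset over the \<open>2 * N + 1\<close> labels is its multiplicity function, with
  values in \<open>{0..n}\<close>; \<open>restrict\<close> places it in the extensional function
  space, whose size is known.\<close>

lemma strip_multisets:
  shows finite_strip_multisets: "finite (strip_multisets N n)"
    and card_strip_multisets: "card (strip_multisets N n) \<le> (n + 1) ^ (2 * N + 1)"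
proof -
  let ?Z = "{0..2 * int N}"
  let ?f = "\<lambda>M. restrict (count M) ?Z"
  have inj: "inj_on ?f (strip_multisets N n)"
  proof (rule inj_onI)
    fix M M' assume M: "M \<in> strip_multisets N n" "M' \<in> strip_multisets N n" and eq: "?f M = ?f M'"
    show "M = M'"
    proof (rule multiset_eqI)
      fix z
      show "count M z = count M' z"
      proof (cases "z \<in> ?Z")
        case True
        then show ?thesis using fun_cong[OF eq, of z] by simp
      next
        case False
        then have "z \<notin># M" "z \<notin># M'" using M by (auto simp: strip_multisets_def)
        then show ?thesis by (simp add: not_in_iff)
      qed
    qed
  qed
  have sub: "?f ` strip_multisets N n \<subseteq> ?Z \<rightarrow>\<^sub>E {0..n}"
  proof (clarsimp simp: PiE_iff strip_multisets_def)
    fix M :: "int multiset" and z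
    show "count M z \<le> size M" by (rule count_le_size)
  qed
  have fin: "finite (?Z \<rightarrow>\<^sub>E {0..n})" by (intro finite_PiE) auto
  show "finite (strip_multisets N n)"
    using inj_on_finite[OF inj sub fin] .
  have "card (strip_multisets N n) \<le> card (?Z \<rightarrow>\<^sub>E {0..n})"
    using card_inj_on_le[OF inj sub fin] .
  also have "\<dots> = (n + 1) ^ (2 * N + 1)"
    by (simp add: card_PiE nat_add_distrib nat_mult_distrib)
  finally show "card (strip_multisets N n) \<le> (n + 1) ^ (2 * N + 1)" .
qed

text \<open>
  For \<open>x = k + u\<close> with \<open>k\<close> the nearest integer, \<open>b = 0\<close> replaces \<open>\<bar>u\<bar>\<close> by \<open>\<bar>u\<bar> / 2\<close> and
  \<open>b = 1\<close> replaces it by \<open>1 / 4 + \<bar>u\<bar> / 2\<close>.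
\<close>

definition spread :: "int \<Rightarrow> real \<Rightarrow> real" where
  "spread b x = x / 2 + of_int (\<lfloor>2 * x\<rfloor> + (\<lfloor>2 * x\<rfloor> + b) mod 2) / 4"

text \<open>Half strip \<open>z\<close> consists of the quarter strips \<open>2 * z\<close> and
  \<open>2 * z + 1\<close>. The parity of \<open>z\<close> tells which of them is nearer to an
  integer; \<open>b = 0\<close> selects the nearer and \<open>b = 1\<close> the farther one.\<close>

lemma floor_4_spread: "\<lfloor>4 * spread b x\<rfloor> = 2 * \<lfloor>2 * x\<rfloor> + (\<lfloor>2 * x\<rfloor> + b) mod 2"
proof -
  have "4 * spread b x = 2 * x + of_int (\<lfloor>2 * x\<rfloor> + (\<lfloor>2 * x\<rfloor> + b) mod 2)"
    by (simp add: spread_def)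
  then show ?thesis by (simp del: of_int_add)
qed

lemma floor_double: "\<lfloor>x :: real\<rfloor> = \<lfloor>2 * x\<rfloor> div 2"
  using floor_divide_real_eq_div[of 2 "2 * x"] by simp

lemma floor_2_spread: "\<lfloor>2 * spread b x\<rfloor> = \<lfloor>2 * x\<rfloor>"
  using floor_double[of "2 * spread b x"] by (simp add: floor_4_spread)

text \<open>On one strip the map is affine with slope \<open>1 / 2\<close>, and points of distinct
  strips stay in order because every strip is mapped into itself.\<close>

lemma spread_strict_mono:
  assumes "x < y"
  shows "spread b x < spread b y"
proof (cases "\<lfloor>2 * x\<rfloor> = \<lfloor>2 * y\<rfloor>")
  case True
  then show ?thesis using assms by (simp add: spread_def)
next
  case False
  then have "\<lfloor>2 * spread b x\<rfloor> < \<lfloor>2 * spread b y\<rfloor>"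
    using assms floor_mono[of "2 * x" "2 * y"] by (simp add: floor_2_spread)
  then show ?thesis
    using floor_mono[of "2 * spread b y" "2 * spread b x"] by linarith
qed

lemma spread_less_iff: "spread b x < spread b y \<longleftrightarrow> x < y"
  using spread_strict_mono[of x y b] spread_strict_mono[of y x b] by (cases x y rule: linorder_cases) auto

lemma spread_off_grid:
  assumes "2 * x \<notin> \<int>"
  shows "2 * spread b x \<notin> \<int>"
proof
  assume "2 * spread b x \<in> \<int>"
  then have "2 * (2 * spread b x) - of_int (\<lfloor>2 * x\<rfloor> + (\<lfloor>2 * x\<rfloor> + b) mod 2) \<in> \<int>"
    by (rule Ints_diff[OF Ints_mult[OF Ints_numeral] Ints_of_int])
  moreover have "2 * (2 * spread b x) - of_int (\<lfloor>2 * x\<rfloor> + (\<lfloor>2 * x\<rfloor> + b) mod 2) = 2 * x"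
    unfolding spread_def by (simp only: field_simps) simp
  ultimately show False using assms by (simp only:)
qed

text \<open>An integer shift changes \<open>\<lfloor>2 * x\<rfloor>\<close> by an even number and
  leaves the parity in the definition unchanged. Thus only the position within a cell
  matters.\<close>

lemma spread_int_add: "spread b (of_int k + x) = of_int k + spread b x"
proof -
  have "\<lfloor>2 * (of_int k + x)\<rfloor> = 2 * k + \<lfloor>2 * x\<rfloor>"
    using int_add_floor[of "2 * k" "2 * x"] by (simp add: distrib_left)
  moreover have "(2 * k + \<lfloor>2 * x\<rfloor> + b) mod 2 = (\<lfloor>2 * x\<rfloor> + b) mod 2"
    by (simp add: add.assoc)
  ultimately have "spread b (of_int k + x) =
      (of_int k + x) / 2 + of_int (2 * k + \<lfloor>2 * x\<rfloor> + (\<lfloor>2 * x\<rfloor> + b) mod 2) / 4"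
    unfolding spread_def by (simp only:)
  then show ?thesis
    unfolding spread_def of_int_add by (simp add: field_simps)
qed

lemma floor_uminus_not_int:
  assumes "(x :: real) \<notin> \<int>"
  shows "\<lfloor>- x\<rfloor> = - \<lfloor>x\<rfloor> - 1"
proof -
  have "x \<noteq> of_int \<lfloor>x\<rfloor>" using assms by (metis Ints_of_int)
  then show ?thesis by (simp add: floor_minus ceiling_altdef)
qed

text \<open>Away from multiples of \<open>1 / 2\<close>, negation sends strip \<open>z\<close> to
  \<open>- z - 1\<close>, with opposite parity and opposite direction, and the two changes cancel.
  This makes segments of slope -1 behave like those of slope 1.\<close>

lemma spread_uminus:
  assumes "2 * x \<notin> \<int>"
  shows "spread b (- x) = - spread b x"
proof -
  have "\<lfloor>2 * (- x)\<rfloor> = - \<lfloor>2 * x\<rfloor> - 1"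
    using floor_uminus_not_int[OF assms] by simp
  moreover have "(- \<lfloor>2 * x\<rfloor> - 1 + b) mod 2 = 1 - (\<lfloor>2 * x\<rfloor> + b) mod 2"
    by presburger
  ultimately have "spread b (- x) =
      - x / 2 + of_int (- \<lfloor>2 * x\<rfloor> - 1 + (1 - (\<lfloor>2 * x\<rfloor> + b) mod 2)) / 4"
    unfolding spread_def by (simp only:)
  also have "\<dots> = - spread b x"
    unfolding spread_def of_int_add of_int_diff of_int_minus of_int_1 by (simp only: field_simps) simp
  finally show ?thesis .
qed

definition spread2 :: "int \<Rightarrow> real \<times> real \<Rightarrow> real \<times> real" where
  "spread2 b p = (spread b (fst p), spread b (snd p))"

lemma fst_spread2 [simp]: "fst (spread2 b p) = spread b (fst p)"
  and snd_spread2 [simp]: "snd (spread2 b p) = spread b (snd p)"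
  by (simp_all add: spread2_def)

lemma inj_spread2: "inj_on (spread2 b) S"
proof (rule inj_onI)
  fix p q assume "spread2 b p = spread2 b q"
  then have "spread b (fst p) = spread b (fst q)" "spread b (snd p) = spread b (snd q)"
    by (simp_all add: spread2_def)
  then show "p = q"
    by (metis prod_eqI linorder_neqE_linordered_idom less_irrefl spread_less_iff)
qed

lemma order_iso_spread2: "order_iso (spread2 b) S (spread2 b ` S)"
  by (simp add: order_iso_def bij_betw_def inj_spread2 spread_less_iff)

lemma general_position_spread2:
  assumes "general_position S"
  shows "general_position (spread2 b ` S)"
proof -
  have "spread b x = spread b y \<longleftrightarrow> x = y" for x y
    by (metis less_irrefl linorder_neqE_linordered_idom spread_less_iff)
  then show ?thesis
    using assms by (auto simp: general_position_def inj_on_def)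
qed

lemma code_spread2:
  assumes "general_position S"
  shows "code (spread2 b ` S) = code S"
proof -
  have "pattern (spread2 b ` S) = pattern S"
    using order_iso_imp_pattern_eq[OF assms general_position_spread2[OF assms] order_iso_spread2] ..
  then show ?thesis
    using assms inj_spread2
    by (simp add: code_def xstrips_def ystrips_def general_position_def floor_2_spread o_def
        image_mset_mset_set[symmetric] multiset.map_comp)
qed

text \<open>Collects what the counting needs of a figure, since it is applied both to the standard
  figure and to one half of it.\<close>

locale grid_figure =
  fixes F :: "(real \<times> real) set" and N :: nat
  assumes bounded: "p \<in> F \<Longrightarrow> fst p \<in> {0..real N} \<and> snd p \<in> {0..real N}"
    and spread2_in: "p \<in> F \<Longrightarrow> off_grid p \<Longrightarrow> spread2 b p \<in> F"
begin

lemma strips_in_strip_multisets: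
  assumes "S \<in> config F n"
  shows "xstrips S \<in> strip_multisets N n" "ystrips S \<in> strip_multisets N n"
proof -
  have "\<lfloor>2 * x\<rfloor> \<in> {0..2 * int N}" if "x \<in> {0..real N}" for x
    using that by (auto simp: floor_le_iff)
  then have "\<lfloor>2 * fst p\<rfloor> \<in> {0..2 * int N}" "\<lfloor>2 * snd p\<rfloor> \<in> {0..2 * int N}" if "p \<in> S" for p
    using bounded[of p] configD(1)[OF assms] that by blast+
  then show "xstrips S \<in> strip_multisets N n" "ystrips S \<in> strip_multisets N n"
    using configD(3,4)[OF assms]
    unfolding strip_multisets_def xstrips_def ystrips_def by auto
qed

lemma finite_patterns: "finite (pattern ` config F n)"
proof (rule finite_subset)
  show "pattern ` config F n \<subseteq> {p. p permutes {1..n}}"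
    using pattern_permutes by (auto simp: config_def)
qed (simp add: finite_permutations)

lemma code_image_subset:
  "code ` config F n \<subseteq> pattern ` config F n \<times> strip_multisets N n \<times> strip_multisets N n"
  using strips_in_strip_multisets by (auto simp: code_def)

lemma finite_codes: "finite (code ` config F n)"
  by (rule finite_subset[OF code_image_subset]) (simp add: finite_patterns finite_strip_multisets)

lemma card_strip_multisets2:
  "card (strip_multisets N n \<times> strip_multisets N n) \<le> (n + 1) ^ (4 * N + 2)"
proof -
  have "card (strip_multisets N n \<times> strip_multisets N n) \<le> (n + 1) ^ (2 * N + 1) * (n + 1) ^ (2 * N + 1)"
    unfolding card_cartesian_product by (intro mult_mono card_strip_multisets) auto
  also have "\<dots> = (n + 1) ^ (4 * N + 2)"
    by (simp only: power_add[symmetric]) (simp add: algebra_simps)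
  finally show ?thesis .
qed

lemma card_patterns_le_codes: "card (pattern ` config F n) \<le> card (code ` config F n)"
proof -
  have "pattern ` config F n = fst ` code ` config F n" by (force simp: code_def)
  then show ?thesis by (metis card_image_le finite_codes)
qed

text \<open>A pattern carries at most polynomially many strip counts, so counting codes instead of
  patterns does not change the growth rate.\<close>

lemma card_codes_le_patterns:
  "card (code ` config F n) \<le> (n + 1) ^ (4 * N + 2) * card (pattern ` config F n)"
proof -
  have "card (code ` config F n) \<le>
      card (pattern ` config F n \<times> strip_multisets N n \<times> strip_multisets N n)"
    using code_image_subset by (intro card_mono) (simp_all add: finite_patterns finite_strip_multisets)
  also have "\<dots> \<le> card (pattern ` config F n) * (n + 1) ^ (4 * N + 2)"
    using card_strip_multisets2[of n] by (simp add: card_cartesian_product)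
  finally show ?thesis by (simp add: mult.commute)
qed

lemma config_spread2:
  assumes "S \<in> config F n"
  shows "spread2 b ` S \<in> config F n"
  using configD[OF assms] general_position_spread2[of S b] card_image[OF inj_spread2, of b S]
  by (auto simp: config_def off_grid_def spread_off_grid intro!: spread2_in)

end

section \<open>Superposing a contracted and an expanded point set\<close>

definition join :: "(real \<times> real) set \<Rightarrow> (real \<times> real) set \<Rightarrow> (real \<times> real) set" where
  "join U V = spread2 0 ` U \<union> spread2 1 ` V"

text \<open>Residues 0 and 3 mark the quarter strips that start or end at an integer, where
  contraction puts all points; expansion uses the residues 1 and 2.\<close>

lemma floor_4_spread_0_mod_4: "\<lfloor>4 * spread 0 x\<rfloor> mod 4 \<in> {0, 3}"
  unfolding floor_4_spread insert_iff empty_iff by presburger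

lemma floor_4_spread_1_mod_4: "\<lfloor>4 * spread 1 x\<rfloor> mod 4 \<in> {1, 2}"
  unfolding floor_4_spread insert_iff empty_iff by presburger

lemma spread_0_neq_spread_1: "spread 0 x \<noteq> spread 1 y"
  using floor_4_spread_0_mod_4[of x] floor_4_spread_1_mod_4[of y] by auto

lemma join_disjoint: "spread2 0 ` U \<inter> spread2 1 ` V = {}"
  using spread_0_neq_spread_1 by (auto simp: spread2_def)

text \<open>The quarter strip of a point of the join is a function of its half strip and of the part
  it comes from, so the strip counts of the parts give the quarter-strip counts of the join.\<close>

lemma floor_4_join:
  assumes "finite U" "finite V"
  shows "image_mset (\<lambda>p. \<lfloor>4 * fst p\<rfloor>) (mset_set (join U V)) =
      image_mset (\<lambda>z. 2 * z + z mod 2) (xstrips U) + image_mset (\<lambda>z. 2 * z + (z + 1) mod 2) (xstrips V)"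
  using assms join_disjoint[of U V]
  by (simp add: join_def mset_set_Union image_mset_mset_set[OF inj_spread2, symmetric]
      multiset.map_comp o_def floor_4_spread xstrips_def)

text \<open>The quarter strip of the x-coordinate alone tells whether a point was contracted or
  expanded.\<close>

lemma join_parts:
  "spread2 0 ` U = {p \<in> join U V. \<lfloor>4 * fst p\<rfloor> mod 4 \<in> {0, 3}}"
  "spread2 1 ` V = {p \<in> join U V. \<lfloor>4 * fst p\<rfloor> mod 4 \<notin> {0, 3}}"
proof -
  define P where "P p \<longleftrightarrow> \<lfloor>4 * fst p\<rfloor> mod 4 \<in> {0, 3}" for p :: "real \<times> real"
  have "P p" if "p \<in> spread2 0 ` U" for p
    using that floor_4_spread_0_mod_4 unfolding P_def by (metis fst_spread2 imageE)
  moreover have "\<not> P p" if "p \<in> spread2 1 ` V" for p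
  proof -
    have "\<lfloor>4 * fst p\<rfloor> mod 4 \<in> {1, 2}"
      using that floor_4_spread_1_mod_4 by (metis fst_spread2 imageE)
    then show ?thesis unfolding P_def by auto
  qed
  ultimately have "spread2 0 ` U = {p \<in> join U V. P p}" "spread2 1 ` V = {p \<in> join U V. \<not> P p}"
    unfolding join_def by blast+
  then show "spread2 0 ` U = {p \<in> join U V. \<lfloor>4 * fst p\<rfloor> mod 4 \<in> {0, 3}}"
    "spread2 1 ` V = {p \<in> join U V. \<lfloor>4 * fst p\<rfloor> mod 4 \<notin> {0, 3}}"
    unfolding P_def .
qed

context grid_figure
begin

lemma join_config:
  assumes U: "U \<in> config F n" and V: "V \<in> config F m"
  shows "join U V \<in> config F (m + n)"
proof -
  note * = config_spread2[OF U, of 0] config_spread2[OF V, of 1]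
  note U' = configD[OF *(1)] and V' = configD[OF *(2)]
  have "general_position (join U V)"
    unfolding general_position_def join_def
    using U'(4-6) V'(4-6) spread_0_neq_spread_1 spread_0_neq_spread_1[symmetric]
    by (auto simp: inj_on_Un)
  then show ?thesis
    using U'(1,3,7) V'(1,3,7) card_Un_disjoint[OF U'(4) V'(4) join_disjoint]
    unfolding config_def join_def by (simp add: ball_Un)
qed

lemma join_strips:
  assumes U: "U \<in> config F n" and V: "V \<in> config F m"
  shows "xstrips (join U V) = xstrips U + xstrips V" "ystrips (join U V) = ystrips U + ystrips V"
proof -
  have "xstrips (spread2 b ` S) = xstrips S" "ystrips (spread2 b ` S) = ystrips S"
    if "S \<in> config F k" for S k b
    using code_spread2[OF configD(2)[OF that]] by (simp_all add: code_def)
  then show "xstrips (join U V) = xstrips U + xstrips V" "ystrips (join U V) = ystrips U + ystrips V"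
    unfolding join_def using assms configD(4)[OF U] configD(4)[OF V]
    by (simp_all add: strips_Un join_disjoint)
qed

text \<open>The strip counts of \<open>U\<close> are those of the join minus those of
  \<open>V\<close>. Hence the quarter-strip counts of the two joins agree, the order isomorphism
  between the joins keeps quarter strips, and it restricts to both parts.\<close>

lemma join_determines:
  assumes U: "U \<in> config F n" "U' \<in> config F n" and V: "V \<in> config F m" "V' \<in> config F m"
    and eq: "code (join U V) = code (join U' V')" "xstrips V = xstrips V'" "ystrips V = ystrips V'"
  shows "code U = code U' \<and> code V = code V'"
proof -
  have strips: "xstrips U = xstrips U'" "ystrips U = ystrips U'"
    using eq join_strips[OF U(1) V(1)] join_strips[OF U(2) V(2)] by (auto simp: code_def)
  let ?W = "join U V" and ?W' = "join U' V'"
  note W = configD[OF join_config[OF U(1) V(1)]] and W' = configD[OF join_config[OF U(2) V(2)]]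
  obtain \<phi> where \<phi>: "order_iso \<phi> ?W ?W'"
    using pattern_eq_imp_order_iso[OF W(2) W'(2)] W(3) W'(3) eq(1) by (auto simp: code_def)
  have lab: "\<lfloor>4 * fst (\<phi> p)\<rfloor> = \<lfloor>4 * fst p\<rfloor>" if "p \<in> ?W" for p
  proof (rule order_iso_label[where k = fst and lab = "\<lambda>x. \<lfloor>4 * x\<rfloor>" and S = ?W and T = ?W'])
    show "mono (\<lambda>x::real. \<lfloor>4 * x\<rfloor>)" by (intro monoI floor_mono) simp
    show "image_mset (\<lambda>p. \<lfloor>4 * fst p\<rfloor>) (mset_set ?W) = image_mset (\<lambda>p. \<lfloor>4 * fst p\<rfloor>) (mset_set ?W')"
      using configD(4)[OF U(1)] configD(4)[OF U(2)] configD(4)[OF V(1)] configD(4)[OF V(2)]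
      by (simp add: floor_4_join strips eq)
  qed (use W \<phi> that in \<open>auto simp: order_iso_def\<close>)
  have "order_iso \<phi> (spread2 0 ` U) (spread2 0 ` U')" "order_iso \<phi> (spread2 1 ` V) (spread2 1 ` V')"
    unfolding join_parts(1)[of U V] join_parts(1)[of U' V'] join_parts(2)[of V U] join_parts(2)[of V' U']
    using \<phi> by (rule order_iso_restrict, simp add: lab)+
  then have "pattern (spread2 0 ` U) = pattern (spread2 0 ` U')"
    "pattern (spread2 1 ` V) = pattern (spread2 1 ` V')"
    using U V configD(2) by (auto intro!: order_iso_imp_pattern_eq intro: general_position_spread2)
  then have "pattern U = pattern U'" "pattern V = pattern V'"
    using code_spread2 U V configD(2) unfolding code_def by (metis prod.inject)+
  then show ?thesis using strips eq by (simp add: code_def)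
qed

text \<open>The codes of a pair are recovered from the code of its join and the strip counts of the
  expanded set. Recording the counts of only one factor makes the polynomial depend on
  \<open>m\<close> alone, which matters when \<open>m\<close> is fixed and the inequality is
  iterated.\<close>

lemma card_codes_supermultiplicative:
  "card (code ` config F n) * card (code ` config F m) \<le>
    (m + 1) ^ (4 * N + 2) * card (code ` config F (m + n))"
proof -
  let ?M = "strip_multisets N m"
  have "card (code ` config F n) * card (code ` config F m) =
      card (map_prod code code ` (config F n \<times> config F m))"
    by (simp add: card_cartesian_product map_prod_surj_on[OF refl refl])
  also have "\<dots> \<le> card (code ` config F (m + n) \<times> ?M \<times> ?M)"
  proof (rule card_image_le_if_determined[where d = "\<lambda>(U, V). (code (join U V), xstrips V, ystrips V)"])
    show "finite (code ` config F (m + n) \<times> ?M \<times> ?M)"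
      by (simp add: finite_codes finite_strip_multisets)
    fix x y
    assume x: "x \<in> config F n \<times> config F m"
    obtain U V where UV: "x = (U, V)" "U \<in> config F n" "V \<in> config F m" using x by blast
    show "(case x of (U, V) \<Rightarrow> (code (join U V), xstrips V, ystrips V))
        \<in> code ` config F (m + n) \<times> ?M \<times> ?M"
      using join_config[OF UV(2,3)] strips_in_strip_multisets[OF UV(3)] by (simp add: UV)
    assume y: "y \<in> config F n \<times> config F m"
    obtain U' V' where UV': "y = (U', V')" "U' \<in> config F n" "V' \<in> config F m" using y by blast
    assume "(case x of (U, V) \<Rightarrow> (code (join U V), xstrips V, ystrips V)) =
        (case y of (U, V) \<Rightarrow> (code (join U V), xstrips V, ystrips V))"
    then show "map_prod code code x = map_prod code code y"
      using join_determines[OF UV(2) UV'(2) UV(3) UV'(3)] by (simp add: UV UV')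
  qed
  also have "\<dots> \<le> (m + 1) ^ (4 * N + 2) * card (code ` config F (m + n))"
    using card_strip_multisets2[of m] by (simp add: card_cartesian_product)
  finally show ?thesis .
qed

end

section \<open>Splitting and symmetrizing\<close>

text \<open>The form in which equality of codes is used: such maps can be glued when the parts
  occupy disjoint strips, whereas the patterns of the parts alone do not fix the pattern of a
  union.\<close>

definition grid_iso :: "(real \<times> real \<Rightarrow> real \<times> real) \<Rightarrow> (real \<times> real) set \<Rightarrow> (real \<times> real) set \<Rightarrow> bool" where
  "grid_iso \<phi> S T \<longleftrightarrow> order_iso \<phi> S T \<and>
    (\<forall>a\<in>S. \<lfloor>2 * fst (\<phi> a)\<rfloor> = \<lfloor>2 * fst a\<rfloor> \<and> \<lfloor>2 * snd (\<phi> a)\<rfloor> = \<lfloor>2 * snd a\<rfloor>)"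

lemma order_iso_xstrips:
  assumes "finite S" "order_iso \<phi> S T" "xstrips S = xstrips T" "a \<in> S"
  shows "\<lfloor>2 * fst (\<phi> a)\<rfloor> = \<lfloor>2 * fst a\<rfloor>"
proof (rule order_iso_label[where k = fst and lab = "\<lambda>x. \<lfloor>2 * x\<rfloor>" and S = S and T = T])
  show "mono (\<lambda>x::real. \<lfloor>2 * x\<rfloor>)" by (intro monoI floor_mono) simp
qed (use assms in \<open>auto simp: order_iso_def xstrips_def\<close>)

lemma order_iso_ystrips:
  assumes "finite S" "order_iso \<phi> S T" "ystrips S = ystrips T" "a \<in> S"
  shows "\<lfloor>2 * snd (\<phi> a)\<rfloor> = \<lfloor>2 * snd a\<rfloor>"
proof (rule order_iso_label[where k = snd and lab = "\<lambda>x. \<lfloor>2 * x\<rfloor>" and S = S and T = T])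
  show "mono (\<lambda>x::real. \<lfloor>2 * x\<rfloor>)" by (intro monoI floor_mono) simp
qed (use assms in \<open>auto simp: order_iso_def ystrips_def\<close>)

lemma code_eq_imp_grid_iso:
  assumes S: "general_position S" and T: "general_position T" and eq: "code S = code T"
  obtains \<phi> where "grid_iso \<phi> S T"
proof -
  have fin: "finite S" "finite T" using S T by (auto simp: general_position_def)
  \<comment> \<open>The number of points is not a separate entry of the code; it is the size of the
    strip multiset.\<close>
  have "size (xstrips S) = size (xstrips T)" using eq by (simp add: code_def)
  then have "card S = card T" by (simp add: xstrips_def)
  moreover have "pattern S = pattern T" using eq by (simp add: code_def)
  ultimately obtain \<phi> where \<phi>: "order_iso \<phi> S T"
    using pattern_eq_imp_order_iso[OF S T] by blast
  have "grid_iso \<phi> S T"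
    unfolding grid_iso_def using \<phi> order_iso_xstrips[OF fin(1) \<phi>] order_iso_ystrips[OF fin(1) \<phi>] eq
    by (simp add: code_def)
  then show ?thesis by (rule that)
qed

lemma grid_iso_imp_code_eq:
  assumes S: "general_position S" and T: "general_position T" and iso: "grid_iso \<phi> S T"
  shows "code S = code T"
proof -
  have o: "order_iso \<phi> S T" and fin: "finite S"
    using S iso by (simp_all add: grid_iso_def general_position_def)
  have m: "mset_set T = image_mset \<phi> (mset_set S)"
    using o by (auto simp: order_iso_def bij_betw_def image_mset_mset_set)
  have "xstrips T = xstrips S" "ystrips T = ystrips S"
    unfolding xstrips_def ystrips_def m multiset.map_comp o_def
    using iso fin by (auto simp: grid_iso_def intro!: image_mset_cong)
  then show ?thesis
    using order_iso_imp_pattern_eq[OF S T o] by (simp add: code_def)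
qed

lemma less_iff_floor_less:
  fixes x y :: real
  assumes "\<lfloor>2 * x\<rfloor> \<noteq> \<lfloor>2 * y\<rfloor>"
  shows "x < y \<longleftrightarrow> \<lfloor>2 * x\<rfloor> < \<lfloor>2 * y\<rfloor>"
  using assms floor_mono[of "2 * x" "2 * y"] floor_mono[of "2 * y" "2 * x"] by linarith

text \<open>Two points from different parts lie in different strips, so the strips decide their
  order, and both maps keep strips.\<close>

lemma grid_iso_Un:
  assumes \<phi>: "grid_iso \<phi> S T" and \<psi>: "grid_iso \<psi> S' T'"
    and x: "\<And>a b. a \<in> S \<Longrightarrow> b \<in> S' \<Longrightarrow> \<lfloor>2 * fst a\<rfloor> \<noteq> \<lfloor>2 * fst b\<rfloor>"
    and y: "\<And>a b. a \<in> S \<Longrightarrow> b \<in> S' \<Longrightarrow> \<lfloor>2 * snd a\<rfloor> \<noteq> \<lfloor>2 * snd b\<rfloor>"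
  shows "grid_iso (\<lambda>a. if a \<in> S then \<phi> a else \<psi> a) (S \<union> S') (T \<union> T')"
proof -
  let ?\<chi> = "\<lambda>a. if a \<in> S then \<phi> a else \<psi> a"
  have disj: "S \<inter> S' = {}" using x by blast
  have \<chi>: "\<And>a. a \<in> S \<Longrightarrow> ?\<chi> a = \<phi> a" "\<And>a. a \<in> S' \<Longrightarrow> ?\<chi> a = \<psi> a" using disj by auto
  have b\<phi>: "bij_betw \<phi> S T" and b\<psi>: "bij_betw \<psi> S' T'"
    using \<phi> \<psi> by (simp_all add: grid_iso_def order_iso_def)
  have lab: "\<lfloor>2 * fst (?\<chi> a)\<rfloor> = \<lfloor>2 * fst a\<rfloor>" "\<lfloor>2 * snd (?\<chi> a)\<rfloor> = \<lfloor>2 * snd a\<rfloor>" if "a \<in> S \<union> S'" for a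
    using that \<phi> \<psi> by (auto simp: grid_iso_def \<chi>)
  \<comment> \<open>A common image would lie in one strip with points of both \<open>S\<close> and
    \<open>S'\<close>.\<close>
  have "T \<inter> T' = {}"
  proof (rule ccontr)
    assume "T \<inter> T' \<noteq> {}"
    then obtain t where "t \<in> \<phi> ` S" "t \<in> \<psi> ` S'"
      using b\<phi> b\<psi> by (auto simp: bij_betw_def)
    then obtain a b where ab: "a \<in> S" "b \<in> S'" "\<phi> a = \<psi> b" by auto
    then have "\<lfloor>2 * fst (?\<chi> a)\<rfloor> = \<lfloor>2 * fst (?\<chi> b)\<rfloor>"
      unfolding \<chi>(1)[OF ab(1)] \<chi>(2)[OF ab(2)] by simp
    then have "\<lfloor>2 * fst a\<rfloor> = \<lfloor>2 * fst b\<rfloor>"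
      using lab(1)[OF UnI1[OF ab(1)]] lab(1)[OF UnI2[OF ab(2)]] by (rule box_equals)
    then show False using x[OF ab(1,2)] by contradiction
  qed
  moreover have "bij_betw ?\<chi> S T" by (rule iffD2[OF bij_betw_cong[OF \<chi>(1)] b\<phi>])
  moreover have "bij_betw ?\<chi> S' T'" by (rule iffD2[OF bij_betw_cong[OF \<chi>(2)] b\<psi>])
  ultimately have "bij_betw ?\<chi> (S \<union> S') (T \<union> T')" by (intro bij_betw_combine)
  moreover have "(fst (?\<chi> a) < fst (?\<chi> b) \<longleftrightarrow> fst a < fst b) \<and> (snd (?\<chi> a) < snd (?\<chi> b) \<longleftrightarrow> snd a < snd b)"
    if ab: "a \<in> S \<union> S'" "b \<in> S \<union> S'" for a b
  proof (cases "a \<in> S \<longleftrightarrow> b \<in> S")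
    case True
    then consider "a \<in> S" "b \<in> S" | "a \<in> S'" "b \<in> S'" using ab by blast
    then show ?thesis
      by cases (use \<phi> \<psi> in \<open>simp_all add: \<chi> grid_iso_def order_iso_def\<close>)
  next
    case False
    then have "\<lfloor>2 * fst a\<rfloor> \<noteq> \<lfloor>2 * fst b\<rfloor>" "\<lfloor>2 * snd a\<rfloor> \<noteq> \<lfloor>2 * snd b\<rfloor>"
      using ab x y by (metis UnE)+
    then show ?thesis
      using less_iff_floor_less[of "fst a" "fst b"] less_iff_floor_less[of "fst (?\<chi> a)" "fst (?\<chi> b)"]
        less_iff_floor_less[of "snd a" "snd b"] less_iff_floor_less[of "snd (?\<chi> a)" "snd (?\<chi> b)"]
      unfolding lab[OF ab(1)] lab[OF ab(2)] by blast
  qed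
  ultimately show ?thesis
    unfolding grid_iso_def order_iso_def using lab by blast
qed

section \<open>The half-turn about the centre of the figure\<close>

lemma floor_int_diff_double:
  fixes x :: real
  assumes "2 * x \<notin> \<int>"
  shows "\<lfloor>2 * real c - 2 * x\<rfloor> = 2 * int c - 1 - \<lfloor>2 * x\<rfloor>"
proof -
  have "\<lfloor>2 * real c - 2 * x\<rfloor> = 2 * int c + \<lfloor>- (2 * x)\<rfloor>"
    using int_add_floor[of "2 * int c" "- (2 * x)"] by simp
  then show ?thesis using floor_uminus_not_int[OF assms] by simp
qed

definition rot :: "nat \<Rightarrow> nat \<Rightarrow> real \<times> real \<Rightarrow> real \<times> real" where
  "rot c r p = (real c - fst p, real r - snd p)"

lemma rot_simps [simp]: "fst (rot c r p) = real c - fst p" "snd (rot c r p) = real r - snd p"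
  "rot c r (rot c r p) = p"
  by (simp_all add: rot_def)

lemma inj_rot: "inj_on (rot c r) S"
  by (metis inj_on_inverseI rot_simps(3))

lemma general_position_rot: "general_position S \<Longrightarrow> general_position (rot c r ` S)"
  by (auto simp: general_position_def inj_on_def)

lemma off_grid_rot: "off_grid p \<Longrightarrow> off_grid (rot c r p)"
proof -
  have "2 * (real n - x) \<in> \<int> \<Longrightarrow> 2 * x \<in> \<int>" for n x
  proof -
    assume "2 * (real n - x) \<in> \<int>"
    then have "of_int (2 * int n) - 2 * (real n - x) \<in> \<int>" by (intro Ints_diff Ints_of_int)
    then show ?thesis by (simp add: algebra_simps)
  qed
  then show "off_grid p \<Longrightarrow> off_grid (rot c r p)" unfolding off_grid_def rot_simps by blast
qed

text \<open>Conjugation by the half-turn reverses both orders twice and, for off-grid points, the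
  strip labels twice as well.\<close>

lemma grid_iso_rot:
  assumes iso: "grid_iso \<phi> (rot c r ` S) (rot c r ` T)"
    and off: "\<And>p. p \<in> S \<Longrightarrow> off_grid p" "\<And>p. p \<in> T \<Longrightarrow> off_grid p"
  shows "grid_iso (\<lambda>p. rot c r (\<phi> (rot c r p))) S T"
proof -
  let ?\<rho> = "rot c r"
  have bij: "bij_betw \<phi> (?\<rho> ` S) (?\<rho> ` T)" using iso by (simp add: grid_iso_def order_iso_def)
  have "bij_betw ?\<rho> S (?\<rho> ` S)" by (simp add: bij_betw_def inj_rot)
  moreover have "bij_betw ?\<rho> (?\<rho> ` T) T" by (simp add: bij_betw_def inj_rot image_image)
  ultimately have "bij_betw (?\<rho> \<circ> (\<phi> \<circ> ?\<rho>)) S T" using bij bij_betw_trans by blast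
  then have b: "bij_betw (\<lambda>p. ?\<rho> (\<phi> (?\<rho> p))) S T" by (simp add: o_def)
  have o: "order_iso (\<lambda>p. ?\<rho> (\<phi> (?\<rho> p))) S T"
    using iso b unfolding grid_iso_def order_iso_def by simp
  have "\<lfloor>2 * fst (?\<rho> (\<phi> (?\<rho> p)))\<rfloor> = \<lfloor>2 * fst p\<rfloor> \<and> \<lfloor>2 * snd (?\<rho> (\<phi> (?\<rho> p)))\<rfloor> = \<lfloor>2 * snd p\<rfloor>"
    if p: "p \<in> S" for p
  proof -
    \<comment> \<open>The image is a half-turned point of \<open>T\<close> and hence off-grid, as
      the reversal of labels requires.\<close>
    have "\<phi> (?\<rho> p) \<in> ?\<rho> ` T" using bij p by (auto simp: bij_betw_def)
    then obtain t where "t \<in> T" "\<phi> (?\<rho> p) = ?\<rho> t" by blast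
    then have q: "off_grid (\<phi> (?\<rho> p))" using off_grid_rot[OF off(2)] by simp
    have "\<lfloor>2 * fst (\<phi> (?\<rho> p))\<rfloor> = \<lfloor>2 * fst (?\<rho> p)\<rfloor>" "\<lfloor>2 * snd (\<phi> (?\<rho> p))\<rfloor> = \<lfloor>2 * snd (?\<rho> p)\<rfloor>"
      using iso p by (auto simp: grid_iso_def)
    then show ?thesis
      using q off(1)[OF p] by (simp add: off_grid_def floor_int_diff_double)
  qed
  then show ?thesis using o by (simp add: grid_iso_def)
qed

lemma strips_rot:
  assumes "\<And>p. p \<in> S \<Longrightarrow> off_grid p" "finite S"
  shows "xstrips (rot c r ` S) = image_mset (\<lambda>z. 2 * int c - 1 - z) (xstrips S)"
    "ystrips (rot c r ` S) = image_mset (\<lambda>z. 2 * int r - 1 - z) (ystrips S)"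
  unfolding xstrips_def ystrips_def
    image_mset_mset_set[OF inj_rot, symmetric] multiset.map_comp o_def
  using assms by (auto simp: off_grid_def floor_int_diff_double intro!: image_mset_cong)

text \<open>The points weakly above \<open>a\<close> and those weakly below it cover
  \<open>S\<close> and share only \<open>a\<close>, whence the \<open>+ 1\<close>.\<close>

lemma rank_antitone:
  assumes fin: "finite S" and inj: "inj_on k S" and \<rho>: "bij_betw \<rho> S S" and a: "a \<in> S"
    and anti: "\<And>p. p \<in> S \<Longrightarrow> k (\<rho> p) = c - k p"
  shows "rank k S (\<rho> a) = card S + 1 - rank k S a"
proof -
  have "{b \<in> S. k b \<le> k (\<rho> a)} = \<rho> ` {b \<in> S. k a \<le> k b}"
  proof (intro equalityI subsetI)
    fix b assume b: "b \<in> {b \<in> S. k b \<le> k (\<rho> a)}"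
    then obtain b' where "b' \<in> S" "b = \<rho> b'" using \<rho> by (auto simp: bij_betw_def)
    then show "b \<in> \<rho> ` {b \<in> S. k a \<le> k b}" using b anti a by simp
  qed (use \<rho> a anti in \<open>auto simp: bij_betw_def\<close>)
  moreover have "inj_on \<rho> {b \<in> S. k a \<le> k b}"
    using \<rho> by (auto simp: bij_betw_def intro: inj_on_subset)
  ultimately have 1: "rank k S (\<rho> a) = card {b \<in> S. k a \<le> k b}"
    by (simp add: rank_def card_image)
  have "{b \<in> S. k a \<le> k b} \<union> {b \<in> S. k b \<le> k a} = S" by auto
  moreover have "{b \<in> S. k a \<le> k b} \<inter> {b \<in> S. k b \<le> k a} = {a}"
    using a inj by (auto simp: inj_on_def)
  ultimately have "card {b \<in> S. k a \<le> k b} + rank k S a = card S + 1"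
    unfolding rank_def using card_Un_Int[of "{b \<in> S. k a \<le> k b}" "{b \<in> S. k b \<le> k a}"] fin by simp
  with 1 show ?thesis by simp
qed

text \<open>The half-turn subtracts both ranks of a point from \<open>card W + 1\<close>, which is
  how \<open>rc_perm\<close> acts on positions and values.\<close>

lemma centrosymmetric_pattern:
  assumes W: "general_position W" and sym: "rot c r ` W = W"
  shows "centrosymmetric_perm (card W) (pattern W)"
  unfolding centrosymmetric_perm_def
proof
  fix i
  let ?n = "card W"
  have fin: "finite W" "inj_on fst W" "inj_on snd W" using W by (simp_all add: general_position_def)
  have bij: "bij_betw (rot c r) W W" by (simp add: bij_betw_def inj_rot sym)
  show "rc_perm ?n (pattern W) i = pattern W i"
  proof (cases "i \<in> {1..?n}")
    case True
    then obtain a where a: "a \<in> W" "i = rank fst W a"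
      using bij_betw_rank_general_position(1)[OF W] by (metis bij_betw_imp_surj_on imageE)
    have x: "rank fst W (rot c r a) = ?n + 1 - i"
      using rank_antitone[OF fin(1,2) bij a(1)] a by simp
    have y: "rank snd W (rot c r a) = ?n + 1 - rank snd W a"
      using rank_antitone[OF fin(1,3) bij a(1)] by simp
    have "rot c r a \<in> W" using a sym by blast
    then have "pattern W (?n + 1 - i) = ?n + 1 - rank snd W a"
      using pattern_rank[OF W] x y by metis
    moreover have "rank snd W a \<le> ?n"
      unfolding rank_def using fin by (intro card_mono) auto
    ultimately have "?n + 1 - pattern W (?n + 1 - i) = rank snd W a" by simp
    then show ?thesis using True a pattern_rank[OF W a(1)] by (simp only: rc_perm_def if_True)
  next
    case False
    then show ?thesis unfolding rc_perm_def pattern_def by (simp only: if_False)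
  qed
qed

text \<open>\<open>X\<close> and \<open>Y\<close> are the columns and the rows of one half, given by
  integer parts of coordinates, so rows count from the bottom. By \<open>X_iff_Y\<close> the two
  descriptions of the half agree, and by \<open>rot_X\<close> the half-turn exchanges the
  halves.\<close>

locale split_figure = grid_figure +
  fixes c r :: nat and X Y :: "int set"
  assumes rot_in: "p \<in> F \<Longrightarrow> rot c r p \<in> F"
    and X_iff_Y: "p \<in> F \<Longrightarrow> off_grid p \<Longrightarrow> \<lfloor>fst p\<rfloor> \<in> X \<longleftrightarrow> \<lfloor>snd p\<rfloor> \<in> Y"
    and rot_X: "p \<in> F \<Longrightarrow> off_grid p \<Longrightarrow> \<lfloor>fst (rot c r p)\<rfloor> \<in> X \<longleftrightarrow> \<lfloor>fst p\<rfloor> \<notin> X"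
begin

definition H :: "(real \<times> real) set" where
  "H = {p \<in> F. \<lfloor>fst p\<rfloor> \<in> X}"

text \<open>Spreading keeps the integer parts of the coordinates, so the half is closed under it as
  well.\<close>

sublocale half: grid_figure H N
proof
  fix p b assume p: "p \<in> H"
  then show "fst p \<in> {0..real N} \<and> snd p \<in> {0..real N}" using bounded by (simp add: H_def)
  assume "off_grid p"
  then show "spread2 b p \<in> H"
    using p spread2_in floor_double[of "fst p"] floor_double[of "spread b (fst p)"]
    by (simp add: H_def floor_2_spread)
qed

lemma H_strips:
  assumes "a \<in> F" "off_grid a" "\<lfloor>fst a\<rfloor> \<in> X" "b \<in> F" "off_grid b" "\<lfloor>fst b\<rfloor> \<notin> X"
  shows "\<lfloor>2 * fst a\<rfloor> \<noteq> \<lfloor>2 * fst b\<rfloor>" "\<lfloor>2 * snd a\<rfloor> \<noteq> \<lfloor>2 * snd b\<rfloor>"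
proof -
  show "\<lfloor>2 * fst a\<rfloor> \<noteq> \<lfloor>2 * fst b\<rfloor>" using assms by (metis floor_double)
  show "\<lfloor>2 * snd a\<rfloor> \<noteq> \<lfloor>2 * snd b\<rfloor>" using assms X_iff_Y by (metis floor_double)
qed

text \<open>The part outside \<open>H\<close> is turned into \<open>H\<close>, so that both parts
  are counted on the same figure.\<close>

lemma config_parts:
  assumes S: "S \<in> config F n"
  defines "k \<equiv> card {p \<in> S. \<lfloor>fst p\<rfloor> \<in> X}"
  shows "k \<le> n" "{p \<in> S. \<lfloor>fst p\<rfloor> \<in> X} \<in> config H k"
    "rot c r ` {p \<in> S. \<lfloor>fst p\<rfloor> \<notin> X} \<in> config H (n - k)"
proof -
  let ?A = "{p \<in> S. \<lfloor>fst p\<rfloor> \<in> X}" and ?B = "{p \<in> S. \<lfloor>fst p\<rfloor> \<notin> X}"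
  note S' = configD[OF S]
  have gp: "general_position {p \<in> S. P p}" for P
    using S'(2) by (auto simp: general_position_def inj_on_def)
  show "k \<le> n" unfolding k_def S'(3)[symmetric] using S'(4) by (intro card_mono) auto
  show "?A \<in> config H k"
    using S' gp by (auto simp: config_def H_def k_def)
  have "?B = S - ?A" by auto
  then have "card ?B = n - k" unfolding k_def using S'(3,4) by (simp add: card_Diff_subset)
  then have "card (rot c r ` ?B) = n - k" by (simp add: card_image inj_rot)
  moreover have "rot c r p \<in> H" "off_grid (rot c r p)" if "p \<in> ?B" for p
    using that S'(1,7) rot_in[of p] rot_X[of p] off_grid_rot[of p] by (auto simp: H_def)
  moreover have "general_position (rot c r ` ?B)" by (intro general_position_rot gp)
  ultimately show "rot c r ` ?B \<in> config H (n - k)"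
    unfolding config_def by blast
qed

text \<open>The halves occupy disjoint strips, so the isomorphisms of the two parts, one of them
  conjugated back by the half-turn, glue to an isomorphism of the whole sets.\<close>

lemma config_parts_determine:
  assumes S: "S \<in> config F n" and T: "T \<in> config F n"
    and eq1: "code {p \<in> S. \<lfloor>fst p\<rfloor> \<in> X} = code {p \<in> T. \<lfloor>fst p\<rfloor> \<in> X}"
    and eq2: "code (rot c r ` {p \<in> S. \<lfloor>fst p\<rfloor> \<notin> X}) = code (rot c r ` {p \<in> T. \<lfloor>fst p\<rfloor> \<notin> X})"
  shows "code S = code T"
proof -
  let ?A = "\<lambda>S. {p \<in> S. \<lfloor>fst p\<rfloor> \<in> X}" and ?B = "\<lambda>S. {p \<in> S. \<lfloor>fst p\<rfloor> \<notin> X}"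
  note S' = configD[OF S] and T' = configD[OF T]
  obtain \<phi> where \<phi>: "grid_iso \<phi> (?A S) (?A T)"
    using code_eq_imp_grid_iso[OF _ _ eq1] configD(2)[OF config_parts(2)[OF S]]
      configD(2)[OF config_parts(2)[OF T]] by blast
  obtain \<psi> where "grid_iso \<psi> (rot c r ` ?B S) (rot c r ` ?B T)"
    using code_eq_imp_grid_iso[OF _ _ eq2] configD(2)[OF config_parts(3)[OF S]]
      configD(2)[OF config_parts(3)[OF T]] by blast
  then have \<psi>: "grid_iso (\<lambda>p. rot c r (\<psi> (rot c r p))) (?B S) (?B T)"
    by (rule grid_iso_rot) (use S'(7) T'(7) in auto)
  have un: "?A S \<union> ?B S = S" "?A T \<union> ?B T = T" by auto
  from grid_iso_Un[OF \<phi> \<psi>] obtain \<chi> where "grid_iso \<chi> S T"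
    unfolding un using H_strips S'(1,7) by blast
  then show ?thesis by (rule grid_iso_imp_code_eq[OF S'(2) T'(2)])
qed

lemma card_codes_le_convolution:
  "card (code ` config F n) \<le>
    (\<Sum>k\<le>n. card (code ` config H k) * card (code ` config H (n - k)))"
proof -
  let ?B = "\<Union>k\<le>n. code ` config H k \<times> code ` config H (n - k)"
  let ?d = "\<lambda>S. (code {p \<in> S. \<lfloor>fst p\<rfloor> \<in> X}, code (rot c r ` {p \<in> S. \<lfloor>fst p\<rfloor> \<notin> X}))"
  have "card (code ` config F n) \<le> card ?B"
  proof (rule card_image_le_if_determined[where d = ?d])
    show "finite ?B" using half.finite_codes by blast
    show "?d S \<in> ?B" if "S \<in> config F n" for S
      using config_parts[OF that] by (intro UN_I[of "card {p \<in> S. \<lfloor>fst p\<rfloor> \<in> X}"]) auto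
    show "code S = code T" if "S \<in> config F n" "T \<in> config F n" "?d S = ?d T" for S T
      using config_parts_determine[OF that(1,2)] that(3) by simp
  qed
  also have "\<dots> \<le> (\<Sum>k\<le>n. card (code ` config H k \<times> code ` config H (n - k)))"
    by (intro card_UN_le) simp
  finally show ?thesis by (simp add: card_cartesian_product)
qed

text \<open>Near-supermultiplicativity on \<open>H\<close> bounds each term of the convolution by a
  polynomial times the count at \<open>n\<close>; the \<open>n + 1\<close> terms raise the exponent
  by one.\<close>

lemma card_codes_le_half: "card (code ` config F n) \<le> (n + 1) ^ (4 * N + 3) * card (code ` config H n)"
proof -
  have "card (code ` config F n) \<le>
      (\<Sum>k\<le>n. card (code ` config H k) * card (code ` config H (n - k)))"
    by (rule card_codes_le_convolution)
  also have "\<dots> \<le> (\<Sum>k\<le>n. (n + 1) ^ (4 * N + 2) * card (code ` config H n))"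
  proof (rule sum_mono)
    fix k assume k: "k \<in> {..n}"
    have "card (code ` config H k) * card (code ` config H (n - k)) \<le>
        (n - k + 1) ^ (4 * N + 2) * card (code ` config H n)"
      using half.card_codes_supermultiplicative[of k "n - k"] k by simp
    also have "\<dots> \<le> (n + 1) ^ (4 * N + 2) * card (code ` config H n)"
      by (intro mult_right_mono power_mono) auto
    finally show "card (code ` config H k) * card (code ` config H (n - k)) \<le>
      (n + 1) ^ (4 * N + 2) * card (code ` config H n)" .
  qed
  also have "\<dots> = (n + 1) ^ Suc (4 * N + 2) * card (code ` config H n)"
    by (simp only: sum_constant card_atMost of_nat_id Suc_eq_plus1[symmetric] power_Suc mult.assoc)
  also have "Suc (4 * N + 2) = 4 * N + 3" by simp
  finally show ?thesis .
qed

definition symmetrize :: "(real \<times> real) set \<Rightarrow> (real \<times> real) set" where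
  "symmetrize S = S \<union> rot c r ` S"

text \<open>The half-turned copy lies in the other half and shares no coordinate with
  \<open>S\<close>, so the union is in general position and \<open>S\<close> is recovered from its
  columns.\<close>

lemma symmetrize:
  assumes S: "S \<in> config H n"
  shows "symmetrize S \<in> config F (2 * n)" "rot c r ` symmetrize S = symmetrize S"
    "xstrips (symmetrize S) = xstrips S + image_mset (\<lambda>z. 2 * int c - 1 - z) (xstrips S)"
    "S = {p \<in> symmetrize S. \<lfloor>fst p\<rfloor> \<in> X}"
proof -
  note S' = configD[OF S]
  let ?R = "rot c r ` S"
  have SX: "p \<in> F" "\<lfloor>fst p\<rfloor> \<in> X" "off_grid p" if "p \<in> S" for p
    using that S'(1,7) by (auto simp: H_def)
  have RX: "p \<in> F" "\<lfloor>fst p\<rfloor> \<notin> X" "off_grid p" if "p \<in> ?R" for p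
  proof -
    from that obtain q where q: "q \<in> S" "p = rot c r q" by blast
    show "p \<in> F" "\<lfloor>fst p\<rfloor> \<notin> X" "off_grid p"
      unfolding q(2) using SX[OF q(1)] rot_in rot_X off_grid_rot by simp_all
  qed
  have disj: "S \<inter> ?R = {}" using SX RX by blast
  have ne: "fst a \<noteq> fst b" "snd a \<noteq> snd b" if "a \<in> S" "b \<in> ?R" for a b
    using H_strips[OF SX(1,3,2)[OF that(1)] RX(1,3,2)[OF that(2)]] by auto
  have gR: "general_position ?R" using S'(2) by (rule general_position_rot)
  have "fst ` (S - ?R) \<inter> fst ` (?R - S) = {}" "snd ` (S - ?R) \<inter> snd ` (?R - S) = {}"
    using ne by (blast elim: imageE)+
  then have "general_position (symmetrize S)"
    unfolding general_position_def symmetrize_def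
    using S'(4-6) gR[unfolded general_position_def] by (simp add: inj_on_Un)
  moreover have "card (symmetrize S) = 2 * n"
    unfolding symmetrize_def using S'(3,4) disj by (simp add: card_Un_disjoint card_image inj_rot)
  ultimately show "symmetrize S \<in> config F (2 * n)"
    using SX RX unfolding config_def symmetrize_def by blast
  show "rot c r ` symmetrize S = symmetrize S"
    by (auto simp: symmetrize_def image_Un image_image)
  show "xstrips (symmetrize S) = xstrips S + image_mset (\<lambda>z. 2 * int c - 1 - z) (xstrips S)"
    unfolding symmetrize_def using strips_Un(1)[OF S'(4) finite_imageI[OF S'(4)] disj]
      strips_rot(1)[OF S'(7,4)] by simp
  show "S = {p \<in> symmetrize S. \<lfloor>fst p\<rfloor> \<in> X}"
    using SX RX unfolding symmetrize_def by blast
qed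

text \<open>The x-strip counts of the symmetrized set follow from those of \<open>S\<close>, so the
  order isomorphism between the symmetrized sets keeps columns and restricts to \<open>S\<close> and
  \<open>T\<close>.\<close>

lemma symmetrize_determines:
  assumes S: "S \<in> config H n" and T: "T \<in> config H n"
    and eq: "pattern (symmetrize S) = pattern (symmetrize T)" "xstrips S = xstrips T" "ystrips S = ystrips T"
  shows "code S = code T"
proof -
  note S' = configD[OF symmetrize(1)[OF S]] and T' = configD[OF symmetrize(1)[OF T]]
  obtain \<phi> where \<phi>: "order_iso \<phi> (symmetrize S) (symmetrize T)"
    using pattern_eq_imp_order_iso[OF S'(2) T'(2)] S'(3) T'(3) eq(1) by auto
  have "xstrips (symmetrize S) = xstrips (symmetrize T)"
    using symmetrize(3)[OF S] symmetrize(3)[OF T] eq(2) by simp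
  then have lab: "\<lfloor>2 * fst (\<phi> p)\<rfloor> = \<lfloor>2 * fst p\<rfloor>" if "p \<in> symmetrize S" for p
    using order_iso_xstrips[OF S'(4) \<phi>] that by blast
  have "\<lfloor>fst (\<phi> p)\<rfloor> = \<lfloor>fst p\<rfloor>" if "p \<in> symmetrize S" for p
    using lab[OF that] floor_double by metis
  then have "order_iso \<phi> {p \<in> symmetrize S. \<lfloor>fst p\<rfloor> \<in> X} {p \<in> symmetrize T. \<lfloor>fst p\<rfloor> \<in> X}"
    by (intro order_iso_restrict[OF \<phi>]) simp
  then have "order_iso \<phi> S T"
    using symmetrize(4)[OF S] symmetrize(4)[OF T] by simp
  then have "pattern S = pattern T"
    using order_iso_imp_pattern_eq configD(2)[OF S] configD(2)[OF T] by blast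
  then show ?thesis using eq by (simp add: code_def)
qed

text \<open>The recorded strip counts are those of the half with \<open>n\<close> points, so the
  polynomial is in \<open>n\<close> although the patterns have size \<open>2 * n\<close>.\<close>

lemma card_codes_half_le_centrosymmetric:
  "card (code ` config H n) \<le> (n + 1) ^ (4 * N + 2) *
    card {p \<in> pattern ` config F (2 * n). centrosymmetric_perm (2 * n) p}"
proof -
  let ?P = "{p \<in> pattern ` config F (2 * n). centrosymmetric_perm (2 * n) p}"
  let ?M = "strip_multisets N n"
  let ?d = "\<lambda>S. (pattern (symmetrize S), xstrips S, ystrips S)"
  have "card (code ` config H n) \<le> card (?P \<times> ?M \<times> ?M)"
  proof (rule card_image_le_if_determined[where d = ?d])
    show "finite (?P \<times> ?M \<times> ?M)" using finite_patterns by (simp add: finite_strip_multisets)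
    show "?d S \<in> ?P \<times> ?M \<times> ?M" if S: "S \<in> config H n" for S
      using symmetrize(1)[OF S] half.strips_in_strip_multisets[OF S]
        centrosymmetric_pattern[OF configD(2)[OF symmetrize(1)[OF S]] symmetrize(2)[OF S]]
        configD(3)[OF symmetrize(1)[OF S]] by auto
    show "code S = code T" if "S \<in> config H n" "T \<in> config H n" "?d S = ?d T" for S T
      using symmetrize_determines[OF that(1,2)] that(3) by simp
  qed
  also have "\<dots> \<le> (n + 1) ^ (4 * N + 2) * card ?P"
    using card_strip_multisets2[of n] by (simp add: card_cartesian_product)
  finally show ?thesis .
qed

lemma card_patterns_le_centrosymmetric:
  "card (pattern ` config F n) \<le> (n + 1) ^ (8 * N + 5) *
    card {p \<in> pattern ` config F (2 * n). centrosymmetric_perm (2 * n) p}"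
proof -
  let ?P = "{p \<in> pattern ` config F (2 * n). centrosymmetric_perm (2 * n) p}"
  have "card (pattern ` config F n) \<le> (n + 1) ^ (4 * N + 3) * card (code ` config H n)"
    using card_patterns_le_codes card_codes_le_half by (rule order_trans)
  also have "\<dots> \<le> (n + 1) ^ (4 * N + 3) * ((n + 1) ^ (4 * N + 2) * card ?P)"
    by (intro mult_left_mono card_codes_half_le_centrosymmetric) simp
  also have "\<dots> = (n + 1) ^ (4 * N + 3 + (4 * N + 2)) * card ?P"
    by (simp only: power_add mult.assoc)
  also have "4 * N + 3 + (4 * N + 2) = 8 * N + 5" by simp
  finally show ?thesis .
qed

end

section \<open>Growth rates\<close>

text \<open>For positive \<open>n\<close> the bound \<open>n + 1 \<le> 2 * n\<close> reduces the
  linear case to the known limits of the roots of \<open>2\<close> and of \<open>n\<close>.\<close>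

lemma root_poly_tendsto_1: "(\<lambda>n. root n (real ((n + 1) ^ K))) \<longlonglongrightarrow> 1"
proof -
  have "(\<lambda>n. root n (real (n + 1))) \<longlonglongrightarrow> 1"
  proof (rule tendsto_sandwich)
    show "\<forall>\<^sub>F n in sequentially. 1 \<le> root n (real (n + 1))"
      using eventually_gt_at_top[of 0] by eventually_elim simp
    show "\<forall>\<^sub>F n in sequentially. root n (real (n + 1)) \<le> root n 2 * root n (real n)"
      using eventually_gt_at_top[of 0]
    proof eventually_elim
      case (elim n)
      then have "root n (real (n + 1)) \<le> root n (2 * real n)" by simp
      then show ?case by (simp add: real_root_mult)
    qed
    show "(\<lambda>n. root n 2 * root n (real n)) \<longlonglongrightarrow> 1"
      using tendsto_mult[OF LIMSEQ_root_const[of 2] LIMSEQ_root] by simp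
  qed simp
  then have "(\<lambda>n. root n (real (n + 1)) ^ K) \<longlonglongrightarrow> 1 ^ K" by (rule tendsto_power)
  moreover have "\<forall>\<^sub>F n in sequentially. root n (real (n + 1)) ^ K = root n (real ((n + 1) ^ K))"
    using eventually_gt_at_top[of 0] by eventually_elim (simp add: real_root_power)
  ultimately show ?thesis by (simp add: tendsto_cong)
qed

lemma eventually_poly_mult_power_le:
  fixes y z :: real
  assumes "0 \<le> y" "y < z"
  shows "\<forall>\<^sub>F n in sequentially. real ((n + 1) ^ K) * y ^ n \<le> z ^ n"
proof -
  have "(\<lambda>n. root n (real ((n + 1) ^ K)) * y) \<longlonglongrightarrow> 1 * y"
    by (intro tendsto_mult root_poly_tendsto_1 tendsto_const)
  then have "\<forall>\<^sub>F n in sequentially. root n (real ((n + 1) ^ K)) * y < z"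
    using assms by (intro order_tendstoD(2)) auto
  then show ?thesis
    using eventually_gt_at_top[of 0]
  proof eventually_elim
    case (elim n)
    then have "(root n (real ((n + 1) ^ K)) * y) ^ n \<le> z ^ n"
      using assms by (intro power_mono) auto
    then show ?case using elim by (simp add: power_mult_distrib real_root_pow_pos2)
  qed
qed

lemma less_root_iff:
  assumes "0 < n" "0 \<le> (z :: real)"
  shows "z < root n x \<longleftrightarrow> z ^ n < x"
  by (metis assms real_root_less_iff real_root_pos2)

lemma ereal_between_nonneg:
  fixes L :: ereal and y :: real
  assumes "0 \<le> y" "ereal y < L"
  obtains z where "y < z" "ereal z < L"
  using ereal_dense2[OF assms(2)] that by auto

text \<open>Two values \<open>w < z\<close> between the target and the limit leave room for the
  polynomial factor.\<close>

lemma le_liminf_root_if_poly_bound: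
  fixes a c :: "nat \<Rightarrow> nat"
  assumes lim: "(\<lambda>n. ereal (root n (real (a n)))) \<longlonglongrightarrow> L"
    and le: "\<And>n. a n \<le> (n + 1) ^ K * c n"
  shows "L \<le> liminf (\<lambda>n. ereal (root n (real (c n))))"
  unfolding le_Liminf_iff
proof (intro allI impI)
  fix y assume y: "y < L"
  show "\<forall>\<^sub>F n in sequentially. y < ereal (root n (real (c n)))"
  proof (cases "y < 0")
    case True
    \<comment> \<open>Roots of counts are nonnegative, so a negative target is always
      exceeded.\<close>
    then show ?thesis by (auto intro!: always_eventually less_le_trans[OF True] real_root_ge_zero)
  next
    case False
    then obtain y0 where y0: "y = ereal y0" "0 \<le> y0" using y by (cases y) auto
    then obtain w where w: "y0 < w" "ereal w < L" using y ereal_between_nonneg[of y0 L] by auto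
    then obtain z where z: "w < z" "ereal z < L" using y0 ereal_between_nonneg[of w L] by auto
    have "\<forall>\<^sub>F n in sequentially. ereal z < ereal (root n (real (a n)))"
      using order_tendstoD(1)[OF lim z(2)] .
    moreover have "\<forall>\<^sub>F n in sequentially. real ((n + 1) ^ K) * w ^ n \<le> z ^ n"
      using y0 w z by (intro eventually_poly_mult_power_le) auto
    ultimately show ?thesis using eventually_gt_at_top[of 0]
    proof eventually_elim
      case (elim n)
      have "real ((n + 1) ^ K) * w ^ n \<le> z ^ n" using elim by simp
      also have "z ^ n < real (a n)" using elim y0 w z by (subst less_root_iff[symmetric]) auto
      also have "\<dots> \<le> real ((n + 1) ^ K) * real (c n)" by (metis le of_nat_le_iff of_nat_mult)
      finally have "w ^ n < real (c n)" by simp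
      then have "w < root n (real (c n))" using elim y0 w by (subst less_root_iff) auto
      then show ?case using y0 w by simp
    qed
  qed
qed

text \<open>A variant of Fekete's argument. One large \<open>m\<close> with
  \<open>z ^ m < a m\<close> is iterated, and the loss \<open>(m + 1) ^ K\<close> of each step is
  absorbed in the gap from \<open>v\<close> to \<open>z\<close>. The remainder modulo
  \<open>m\<close> and the factor between \<open>a\<close> and \<open>g\<close> are absorbed in the
  gap from \<open>w\<close> to \<open>v\<close>.\<close>

lemma supermultiplicative_root_convergent:
  fixes a g :: "nat \<Rightarrow> nat"
  assumes a_le: "\<And>n. a n \<le> g n" and g_le: "\<And>n. g n \<le> (n + 1) ^ K * a n"
    and super: "\<And>m n. g n * g m \<le> (m + 1) ^ K * g (m + n)"
    and pos: "\<And>n. 1 \<le> g n"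
  obtains L where "(\<lambda>n. ereal (root n (real (a n)))) \<longlonglongrightarrow> L"
proof -
  let ?X = "\<lambda>n. ereal (root n (real (a n)))"
  have "limsup ?X \<le> liminf ?X"
    unfolding le_Liminf_iff
  proof (intro allI impI)
    fix y assume y: "y < limsup ?X"
    show "\<forall>\<^sub>F n in sequentially. y < ?X n"
    proof (cases "y < 0")
      case True
      then show ?thesis by (auto intro!: always_eventually less_le_trans[OF True] real_root_ge_zero)
    next
      case False
      then obtain y0 where y0: "y = ereal y0" "0 \<le> y0" using y by (cases y) auto
      then obtain w where w: "y0 < w" "ereal w < limsup ?X"
        using y ereal_between_nonneg[of y0 "limsup ?X"] by auto
      then obtain v where v: "w < v" "ereal v < limsup ?X"
        using y0 ereal_between_nonneg[of w "limsup ?X"] by auto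
      then obtain z where z: "v < z" "ereal z < limsup ?X"
        using y0 w ereal_between_nonneg[of v "limsup ?X"] by auto
      \<comment> \<open>As \<open>z\<close> is below the limsup, it is exceeded infinitely often,
        hence also by some \<open>m\<close> large enough for the polynomial estimate.\<close>
      have "\<exists>\<^sub>F m in sequentially. \<not> ?X m \<le> ereal z"
        unfolding frequently_def not_not using z(2) Limsup_bounded[of ?X "ereal z" sequentially]
        by (auto simp: not_less[symmetric])
      moreover have "\<forall>\<^sub>F m in sequentially. real ((m + 1) ^ K) * v ^ m \<le> z ^ m \<and> 0 < m"
        using y0 w v z by (intro eventually_conj eventually_poly_mult_power_le eventually_gt_at_top) auto
      ultimately have "\<exists>\<^sub>F m in sequentially.
          (real ((m + 1) ^ K) * v ^ m \<le> z ^ m \<and> 0 < m) \<and> \<not> ?X m \<le> ereal z"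
        by (rule frequently_eventually_conj)
      then obtain m where m: "real ((m + 1) ^ K) * v ^ m \<le> z ^ m" "0 < m" "z < root m (real (a m))"
        by (auto dest!: frequently_ex)
      have "real ((m + 1) ^ K) * v ^ m \<le> z ^ m" by fact
      also have "z ^ m < real (a m)" using m(2,3) y0 w v z by (subst less_root_iff[symmetric]) auto
      also have "\<dots> \<le> real (g m)" using a_le by simp
      finally have gm: "real ((m + 1) ^ K) * v ^ m \<le> real (g m)" by simp
      have v0: "0 < v" using y0 w v by simp
      \<comment> \<open>The remainder \<open>s\<close> starts the induction; positivity of
        \<open>g\<close> is its base case.\<close>
      have iter: "v ^ (m * q) \<le> real (g (m * q + s))" for q s
      proof (induction q)
        case 0
        then show ?case using pos[of s] by simp
      next
        case (Suc q)
        have "real ((m + 1) ^ K) * v ^ (m * Suc q) = v ^ (m * q) * (real ((m + 1) ^ K) * v ^ m)"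
          by (simp add: power_add)
        also have "\<dots> \<le> real (g (m * q + s)) * real (g m)"
          using Suc gm v0 by (intro mult_mono) auto
        also have "\<dots> \<le> real ((m + 1) ^ K) * real (g (m + (m * q + s)))"
          using super[of "m * q + s" m] by (metis of_nat_le_iff of_nat_mult)
        finally show ?case by (simp add: add.assoc)
      qed
      \<comment> \<open>\<open>D\<close> bounds all powers \<open>v ^ (n mod m)\<close>, whether the
        powers of \<open>v\<close> grow or shrink.\<close>
      define D where "D = max 1 (v ^ m)"
      have lower: "v ^ n \<le> D * real (g n)" for n
      proof -
        have "v ^ (n mod m) \<le> D"
        proof (cases "1 \<le> v")
          case True
          then have "v ^ (n mod m) \<le> v ^ m"
            using m(2) by (intro power_increasing) auto
          then show ?thesis by (simp add: D_def)
        next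
          case False
          then have "v ^ (n mod m) \<le> 1" using v0 by (intro power_le_one) auto
          then show ?thesis by (simp add: D_def)
        qed
        moreover have "v ^ (m * (n div m)) \<le> real (g n)"
          using iter[of "n div m" "n mod m"] by simp
        ultimately have "v ^ (n mod m) * v ^ (m * (n div m)) \<le> D * real (g n)"
          using v0 by (intro mult_mono) (auto simp: D_def)
        then show ?thesis by (simp flip: power_add)
      qed
      \<comment> \<open>In the exponent, \<open>K\<close> pays for passing from \<open>g\<close> to
        \<open>a\<close>, and one more factor dominates the constant \<open>D\<close>.\<close>
      have "\<forall>\<^sub>F n in sequentially. real ((n + 1) ^ (K + 1)) * w ^ n \<le> v ^ n"
        using y0 w v by (intro eventually_poly_mult_power_le) auto
      moreover have "\<forall>\<^sub>F n in sequentially. D \<le> real (n + 1)"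
        using eventually_ge_at_top[of "nat \<lceil>D\<rceil>"] by eventually_elim linarith
      ultimately show ?thesis using eventually_gt_at_top[of 0]
      proof eventually_elim
        case (elim n)
        have "real ((n + 1) ^ (K + 1)) * w ^ n \<le> v ^ n" using elim by simp
        also have "\<dots> \<le> D * real (g n)" by (rule lower)
        also have "\<dots> \<le> real (n + 1) * real ((n + 1) ^ K * a n)"
          using elim g_le[of n] by (intro mult_mono) (auto simp del: of_nat_mult of_nat_power)
        also have "\<dots> = real ((n + 1) ^ (K + 1)) * real (a n)"
          by (simp only: power_add power_one_right of_nat_mult mult.assoc mult.commute mult.left_commute)
        finally have "w ^ n \<le> real (a n)" by (rule mult_left_le_imp_le) (simp only: of_nat_0_less_iff zero_less_power add_pos_pos zero_less_one trans_less_add2)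
        \<comment> \<open>Cancelling the polynomial gave only a weak inequality; strictness comes
          from \<open>y0 < w\<close>.\<close>
        moreover have "y0 ^ n < w ^ n" using elim y0 w by (intro power_strict_mono) auto
        ultimately have "y0 < root n (real (a n))" using elim y0 by (subst less_root_iff) auto
        then show ?case using y0 by simp
      qed
    qed
  qed
  then have "liminf ?X = limsup ?X" using Liminf_le_Limsup[of sequentially ?X] by (intro antisym) auto
  then have "?X \<longlonglongrightarrow> limsup ?X" by (intro iffD2[OF tendsto_iff_Liminf_eq_Limsup]) auto
  then show ?thesis by (rule that)
qed

section \<open>The cell graph\<close>

lemma rc_cell_in_cells:
  assumes "centrosymmetric_mat A" "v \<in> cells A"
  shows "rc_cell A v \<in> cells A"
proof -
  obtain i j where v: "v = (i, j)" "i < dim_row A" "j < dim_col A" "A $$ (i, j) \<noteq> 0"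
    using assms(2) by (auto simp: cells_def)
  then have "A $$ (dim_row A - 1 - i, dim_col A - 1 - j) \<noteq> 0"
    using assms(1) unfolding centrosymmetric_mat_def by metis
  then show ?thesis using v(2,3) by (simp add: v(1) cells_def rc_cell_def)
qed

lemma rc_cell_rc_cell: "v \<in> cells A \<Longrightarrow> rc_cell A (rc_cell A v) = v"
  by (auto simp: cells_def rc_cell_def)

lemma rc_cell_edge:
  assumes A: "centrosymmetric_mat A" and uv: "(u, v) \<in> cell_edges A"
  shows "(rc_cell A u, rc_cell A v) \<in> cell_edges A"
proof -
  obtain i j k l where u: "u = (i, j)" and v: "v = (k, l)" by (cases u, cases v)
  have in_cells: "u \<in> cells A" "v \<in> cells A" and ne: "u \<noteq> v" using uv by (auto simp: cell_edges_def)
  have lt: "i < dim_row A" "j < dim_col A" "k < dim_row A" "l < dim_col A"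
    using in_cells by (auto simp: u v cells_def)
  have ne': "rc_cell A u \<noteq> rc_cell A v" using rc_cell_rc_cell in_cells ne by metis
  note in_cells' = rc_cell_in_cells[OF A in_cells(1)] rc_cell_in_cells[OF A in_cells(2)]
  consider (row) "i = k" "\<forall>m. min j l < m \<and> m < max j l \<longrightarrow> (i, m) \<notin> cells A"
    | (col) "j = l" "\<forall>m. min i k < m \<and> m < max i k \<longrightarrow> (m, j) \<notin> cells A"
    using uv by (auto simp: cell_edges_def u v)
  then show ?thesis
  proof cases
    case row
    have "(dim_row A - 1 - i, m) \<notin> cells A"
      if m: "min (dim_col A - 1 - j) (dim_col A - 1 - l) < m" "m < max (dim_col A - 1 - j) (dim_col A - 1 - l)" for m
    proof
      assume "(dim_row A - 1 - i, m) \<in> cells A"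
      from rc_cell_in_cells[OF A this] have "(i, dim_col A - 1 - m) \<in> cells A"
        using lt by (simp add: rc_cell_def)
      moreover have "min j l < dim_col A - 1 - m" "dim_col A - 1 - m < max j l"
        using m lt by (auto simp: min_def max_def split: if_splits)
      ultimately show False using row by blast
    qed
    then show ?thesis
      using row in_cells' ne' by (simp add: cell_edges_def u v rc_cell_def)
  next
    case col
    have "(m, dim_col A - 1 - j) \<notin> cells A"
      if m: "min (dim_row A - 1 - i) (dim_row A - 1 - k) < m" "m < max (dim_row A - 1 - i) (dim_row A - 1 - k)" for m
    proof
      assume "(m, dim_col A - 1 - j) \<in> cells A"
      from rc_cell_in_cells[OF A this] have "(dim_row A - 1 - m, j) \<in> cells A"
        using lt by (simp add: rc_cell_def)
      moreover have "min i k < dim_row A - 1 - m" "dim_row A - 1 - m < max i k"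
        using m lt by (auto simp: min_def max_def split: if_splits)
      ultimately show False using col by blast
    qed
    then show ?thesis
      using col in_cells' ne' by (simp add: cell_edges_def u v rc_cell_def)
  qed
qed

text \<open>In an even dimension no index is its own mirror image, so a cell shares neither row nor
  column with its rotation, while adjacency requires a shared line.\<close>

lemma rc_cell_not_adjacent:
  assumes "even (dim_row A)" "even (dim_col A)" "v \<in> cells A"
  shows "rc_cell A v \<noteq> v" "(v, rc_cell A v) \<notin> cell_edges A"
proof -
  obtain i j where v: "v = (i, j)" "i < dim_row A" "j < dim_col A"
    using assms(3) by (auto simp: cells_def)
  have "dim_row A - 1 - i \<noteq> i" "dim_col A - 1 - j \<noteq> j"
    using assms(1,2) v(2,3) by presburger+
  then show "rc_cell A v \<noteq> v" "(v, rc_cell A v) \<notin> cell_edges A"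
    by (auto simp: v rc_cell_def cell_edges_def)
qed

lemma cell_edges_subset: "cell_edges A \<subseteq> cells A \<times> cells A"
  by (auto simp: cell_edges_def)

lemma sym_cell_edges: "sym (cell_edges A)"
  by (auto simp: sym_def cell_edges_def min.commute max.commute)

lemma rc_cell_reachable:
  assumes A: "centrosymmetric_mat A" and "(u, v) \<in> (cell_edges A)\<^sup>*"
  shows "(rc_cell A u, rc_cell A v) \<in> (cell_edges A)\<^sup>*"
  using assms(2) by induction (auto intro: rtrancl_into_rtrancl rc_cell_edge[OF A])

text \<open>The graph argument for an involutive automorphism \<open>h\<close>: a walk
  \<open>f\<close> from \<open>w\<close> to \<open>h w\<close> of length \<open>d\<close>, minimal
  over all \<open>w\<close>, closes up with its image under \<open>h\<close> to a cycle of length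
  \<open>2 * d\<close>.\<close>

lemma forest_involution_not_reachable:
  assumes forest: "is_forest E" and EV: "E \<subseteq> V \<times> V"
    and hV: "\<And>v. v \<in> V \<Longrightarrow> h v \<in> V" and hh: "\<And>v. v \<in> V \<Longrightarrow> h (h v) = v"
    and hE: "\<And>u v. (u, v) \<in> E \<Longrightarrow> (h u, h v) \<in> E"
    and fix_free: "\<And>v. v \<in> V \<Longrightarrow> h v \<noteq> v" and no_flip: "\<And>v. v \<in> V \<Longrightarrow> (v, h v) \<notin> E"
    and v: "v \<in> V"
  shows "(v, h v) \<notin> E\<^sup>*"
proof
  assume "(v, h v) \<in> E\<^sup>*"
  then have "\<exists>d. \<exists>v\<in>V. (v, h v) \<in> E ^^ d" using v by (metis rtrancl_imp_relpow)
  define d where "d = (LEAST d. \<exists>v\<in>V. (v, h v) \<in> E ^^ d)"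
  have "\<exists>v\<in>V. (v, h v) \<in> E ^^ d"
    unfolding d_def by (rule LeastI_ex) fact
  then obtain w where w: "w \<in> V" "(w, h w) \<in> E ^^ d" by blast
  have minimal: "d \<le> e" if "u \<in> V" "(u, h u) \<in> E ^^ e" for u e
    unfolding d_def using that by (intro Least_le) blast
  obtain f where f: "f 0 = w" "f d = h w" "\<And>i. i < d \<Longrightarrow> (f i, f (Suc i)) \<in> E"
    using w(2) unfolding relpow_fun_conv by blast
  \<comment> \<open>Length 0 would be a fixed point and length 1 an edge from \<open>w\<close> to
    \<open>h w\<close>; so the cycle has at least 4 vertices.\<close>
  have d2: "2 \<le> d"
  proof (rule ccontr)
    assume "\<not> 2 \<le> d"
    then consider "d = 0" | "d = 1" by linarith
    then show False
      using f fix_free[OF w(1)] no_flip[OF w(1)] by cases auto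
  qed
  have fV: "f i \<in> V" if "i \<le> d" for i
    using that w f(1) f(3)[of "i - 1"] EV by (cases i) auto
  have seg: "(f i, f j) \<in> E ^^ (j - i)" if "i \<le> j" "j \<le> d" for i j
    unfolding relpow_fun_conv using that f(3) by (intro exI[of _ "\<lambda>k. f (i + k)"]) auto
  have f_inj: "f i \<noteq> f j" if "i < j" "j \<le> d" for i j
  proof
    assume eq: "f i = f j"
    have "(w, f i) \<in> E ^^ i" using seg[of 0 i] that f(1) by simp
    moreover have "(f i, h w) \<in> E ^^ (d - j)" using seg[of j d] that f(2) eq by simp
    ultimately have "(w, h w) \<in> E ^^ (i + (d - j))" by (auto simp: relpow_add)
    from minimal[OF w(1) this] show False using that by linarith
  qed
  \<comment> \<open>If the walk met its image, the stretch between the two indices would lead from a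
    vertex to its own image in fewer than \<open>d\<close> steps.\<close>
  have no_meet: "f i \<noteq> h (f j)" if "i < d" "j < d" for i j
  proof
    assume eq: "f i = h (f j)"
    have "(f j, h (f j)) \<in> E ^^ (if j \<le> i then i - j else j - i)"
    proof (cases "j \<le> i")
      case True
      then show ?thesis using seg[of j i] that eq by simp
    next
      case False
      have "h (f i) = f j" using eq hh fV that by simp
      moreover have "(f i, f j) \<in> E ^^ (j - i)" using seg[of i j] that False by simp
      ultimately have "(f i, h (f i)) \<in> E ^^ (j - i)" by simp
      then have "d \<le> j - i" using that by (intro minimal[of "f i"] fV) auto
      then show ?thesis using that by linarith
    qed
    then have "d \<le> (if j \<le> i then i - j else j - i)" using that by (intro minimal[of "f j"] fV) auto
    then show False using that by (simp split: if_splits)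
  qed
  \<comment> \<open>The ends \<open>f d = h (f 0)\<close> and \<open>h (f d) = f 0\<close> are left
    out of their halves because each begins the other half.\<close>
  define xs where "xs = map f [0..<d] @ map (\<lambda>i. h (f i)) [0..<d]"
  have h_inj: "h (f i) \<noteq> h (f j)" if "i < j" "j < d" for i j
    using f_inj[of i j] hh[OF fV[of i]] hh[OF fV[of j]] that by (metis less_imp_le less_trans)
  have dist: "distinct xs"
    unfolding xs_def distinct_append distinct_map
    using f_inj h_inj no_meet
    by (auto simp: inj_on_def) (metis less_imp_le linorder_neqE_nat, metis linorder_neqE_nat)
  have len: "length xs = 2 * d" by (simp add: xs_def)
  have nth: "xs ! k = (if k < d then f k else h (f (k - d)))" if "k < 2 * d" for k
    using that by (auto simp: xs_def nth_append)
  have "(xs ! k, xs ! (Suc k mod length xs)) \<in> E" if k: "k < length xs" for k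
  proof -
    consider "Suc k < d" | "Suc k = d" | "d \<le> k" "Suc k < 2 * d" | "Suc k = 2 * d"
      using k len by linarith
    then show ?thesis
    proof cases
      case 1
      then show ?thesis using f(3)[of k] by (simp add: nth len)
    next
      case 2
      then show ?thesis using f(3)[of k] f(1,2) d2 by (simp add: nth len)
    next
      case 3
      then have "Suc k - d = Suc (k - d)" by simp
      then show ?thesis using 3 hE[OF f(3)[of "k - d"]] by (simp add: nth len)
    next
      case 4
      then have "Suc (k - d) = d" by simp
      then have "(h (f (k - d)), h (f d)) \<in> E" using hE[OF f(3)[of "k - d"]] by simp
      moreover have "h (f d) = f 0" using f hh[OF w(1)] by simp
      ultimately show ?thesis using 4 d2 by (simp add: nth len)
    qed
  qed
  then have "is_cycle E xs" unfolding is_cycle_def using dist len d2 by auto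
  then show False using forest by (auto simp: is_forest_def)
qed

section \<open>Components, their rotations and the lines of the matrix\<close>

lemma component_eq:
  assumes "v \<in> cells A"
  shows "((cell_edges A)\<^sup>* \<inter> cells A \<times> cells A) `` {v} = {w. (v, w) \<in> (cell_edges A)\<^sup>*}"
proof -
  have "w \<in> cells A" if "(v, w) \<in> (cell_edges A)\<^sup>*" for w
    using that assms cell_edges_subset by (induction) blast+
  then show ?thesis using assms by blast
qed

lemma components_eq:
  "components (cells A) (cell_edges A) = (\<lambda>v. {w. (v, w) \<in> (cell_edges A)\<^sup>*}) ` cells A"
  unfolding components_def quotient_def using component_eq by blast

lemma rc_cell_component:
  assumes A: "centrosymmetric_mat A" and v: "v \<in> cells A"
  shows "rc_cell A ` {w. (v, w) \<in> (cell_edges A)\<^sup>*} = {w. (rc_cell A v, w) \<in> (cell_edges A)\<^sup>*}"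
proof (intro equalityI subsetI)
  fix w assume "w \<in> {w. (rc_cell A v, w) \<in> (cell_edges A)\<^sup>*}"
  then have w: "(rc_cell A v, w) \<in> (cell_edges A)\<^sup>*" by simp
  then have "w \<in> cells A"
    using component_eq[OF rc_cell_in_cells[OF A v]] by blast
  then have "w = rc_cell A (rc_cell A w)" by (simp add: rc_cell_rc_cell)
  moreover have "(v, rc_cell A w) \<in> (cell_edges A)\<^sup>*"
    using rc_cell_reachable[OF A w] v by (simp add: rc_cell_rc_cell)
  ultimately show "w \<in> rc_cell A ` {w. (v, w) \<in> (cell_edges A)\<^sup>*}" by blast
next
  fix w assume "w \<in> rc_cell A ` {w. (v, w) \<in> (cell_edges A)\<^sup>*}"
  then obtain u where "(v, u) \<in> (cell_edges A)\<^sup>*" "w = rc_cell A u" by (elim imageE) simp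
  then show "w \<in> {w. (rc_cell A v, w) \<in> (cell_edges A)\<^sup>*}"
    using rc_cell_reachable[OF A] by simp
qed

lemma forest_imp_rc_moves_components:
  assumes A: "centrosymmetric_mat A" and ev: "even (dim_row A)" "even (dim_col A)"
    and forest: "is_forest (cell_edges A)"
  shows "rc_moves_components A"
  unfolding rc_moves_components_def
proof
  fix C assume "C \<in> components (cells A) (cell_edges A)"
  then obtain v where v: "v \<in> cells A" "C = {w. (v, w) \<in> (cell_edges A)\<^sup>*}"
    unfolding components_eq by blast
  have rcC: "rc_cell A ` C = {w. (rc_cell A v, w) \<in> (cell_edges A)\<^sup>*}"
    unfolding v(2) by (rule rc_cell_component[OF A v(1)])
  have "(v, rc_cell A v) \<notin> (cell_edges A)\<^sup>*"
    by (rule forest_involution_not_reachable[OF forest cell_edges_subset])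
      (use v A ev rc_cell_in_cells rc_cell_rc_cell rc_cell_edge rc_cell_not_adjacent in auto)
  then have "rc_cell A ` C \<noteq> C" unfolding rcC v(2) by blast
  then show "rc_cell A ` C \<in> components (cells A) (cell_edges A) \<and> rc_cell A ` C \<noteq> C"
    unfolding rcC components_eq using rc_cell_in_cells[OF A v(1)] by blast
qed

text \<open>Consecutive non-zero cells of a row are adjacent; induction on the gap splits at a
  non-zero cell between the two. Hence each row meets only one component.\<close>

lemma row_connected:
  assumes "(i, j) \<in> cells A" "(i, l) \<in> cells A" "j \<le> l"
  shows "((i, j), (i, l)) \<in> (cell_edges A)\<^sup>*"
  using assms
proof (induction "l - j" arbitrary: j l rule: less_induct)
  case less
  show ?case
  proof (cases "\<exists>m. j < m \<and> m < l \<and> (i, m) \<in> cells A")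
    case True
    then obtain m where m: "j < m" "m < l" "(i, m) \<in> cells A" by blast
    then have "((i, j), (i, m)) \<in> (cell_edges A)\<^sup>*" "((i, m), (i, l)) \<in> (cell_edges A)\<^sup>*"
      using less by auto
    then show ?thesis by (rule rtrancl_trans)
  next
    case False
    then have "j = l \<or> ((i, j), (i, l)) \<in> cell_edges A"
      using less.prems by (auto simp: cell_edges_def)
    then show ?thesis by auto
  qed
qed

lemma col_connected:
  assumes "(i, j) \<in> cells A" "(k, j) \<in> cells A" "i \<le> k"
  shows "((i, j), (k, j)) \<in> (cell_edges A)\<^sup>*"
  using assms
proof (induction "k - i" arbitrary: i k rule: less_induct)
  case less
  show ?case
  proof (cases "\<exists>m. i < m \<and> m < k \<and> (m, j) \<in> cells A")
    case True
    then obtain m where m: "i < m" "m < k" "(m, j) \<in> cells A" by blast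
    then have "((i, j), (m, j)) \<in> (cell_edges A)\<^sup>*" "((m, j), (k, j)) \<in> (cell_edges A)\<^sup>*"
      using less by auto
    then show ?thesis by (rule rtrancl_trans)
  next
    case False
    then have "i = k \<or> ((i, j), (k, j)) \<in> cell_edges A"
      using less.prems by (auto simp: cell_edges_def)
    then show ?thesis by auto
  qed
qed

lemma finite_cells: "finite (cells A)"
  by (rule finite_subset[of _ "{..<dim_row A} \<times> {..<dim_col A}"]) (auto simp: cells_def)

text \<open>Of each pair of swapped components, \<open>B\<close> keeps the one containing the smaller code number.\<close>

lemma rc_moves_components_half:
  assumes A: "centrosymmetric_mat A" and moves: "rc_moves_components A"
  shows "\<exists>B. (\<forall>v\<in>cells A. rc_cell A v \<in> B \<longleftrightarrow> v \<notin> B) \<and>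
    (\<forall>i j l. (i, j) \<in> cells A \<longrightarrow> (i, l) \<in> cells A \<longrightarrow> ((i, j) \<in> B \<longleftrightarrow> (i, l) \<in> B)) \<and>
    (\<forall>i j k. (i, j) \<in> cells A \<longrightarrow> (k, j) \<in> cells A \<longrightarrow> ((i, j) \<in> B \<longleftrightarrow> (k, j) \<in> B))"
proof -
  let ?E = "(cell_edges A)\<^sup>*"
  define K where "K v = {w. (v, w) \<in> ?E}" for v
  \<comment> \<open>The least encoded cell is a value attached to the component, so comparing it for
    \<open>v\<close> and its rotation gives the same answer for all cells of one component.\<close>
  define \<mu> where "\<mu> v = Min (prod_encode ` K v)" for v
  define B where "B = {v. \<mu> v < \<mu> (rc_cell A v)}"
  have sym: "sym ?E" by (intro sym_rtrancl sym_cell_edges)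
  have K_eq: "K u = K v" if "(u, v) \<in> ?E" for u v
    using that sym unfolding K_def by (auto intro: rtrancl_trans dest: symD)
  have same: "u \<in> B \<longleftrightarrow> v \<in> B" if "(u, v) \<in> ?E" for u v
    using K_eq[OF that] K_eq[OF rc_cell_reachable[OF A that]] by (simp add: B_def \<mu>_def)
  have fin: "finite (K v)" "v \<in> K v" if "v \<in> cells A" for v
    using component_eq[OF that] finite_cells[of A] unfolding K_def
    by (auto intro: finite_subset)
  have \<mu>_mem: "\<exists>w \<in> K v. \<mu> v = prod_encode w" if "v \<in> cells A" for v
  proof -
    have "Min (prod_encode ` K v) \<in> prod_encode ` K v" using fin[OF that] by (intro Min_in) auto
    then show ?thesis unfolding \<mu>_def by (elim imageE) blast
  qed
  \<comment> \<open>The encoding is injective, so equal minima come from a common cell, which would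
    put \<open>v\<close> and its rotation into one component.\<close>
  have ne: "\<mu> v \<noteq> \<mu> (rc_cell A v)" if v: "v \<in> cells A" for v
  proof
    assume "\<mu> v = \<mu> (rc_cell A v)"
    then obtain w where w: "w \<in> K v" "w \<in> K (rc_cell A v)"
      using \<mu>_mem[OF v] \<mu>_mem[OF rc_cell_in_cells[OF A v]] by auto
    then have "K v = K (rc_cell A v)" using K_eq unfolding K_def by blast
    moreover have "K v \<in> components (cells A) (cell_edges A)"
      unfolding components_eq K_def using v by blast
    moreover have "rc_cell A ` K v = K (rc_cell A v)"
      unfolding K_def by (rule rc_cell_component[OF A v])
    ultimately show False using moves by (auto simp: rc_moves_components_def)
  qed
  show ?thesis
  proof (intro exI[of _ B] conjI ballI allI impI)
    show "rc_cell A v \<in> B \<longleftrightarrow> v \<notin> B" if "v \<in> cells A" for v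
      using ne[OF that] rc_cell_rc_cell[OF that] by (auto simp: B_def)
    show "(i, j) \<in> B \<longleftrightarrow> (i, l) \<in> B" if "(i, j) \<in> cells A" "(i, l) \<in> cells A" for i j l
      using same row_connected[OF that] row_connected[OF that(2,1)] by (meson linear)
    show "(i, j) \<in> B \<longleftrightarrow> (k, j) \<in> B" if "(i, j) \<in> cells A" "(k, j) \<in> cells A" for i j k
      using same col_connected[OF that] col_connected[OF that(2,1)] by (meson linear)
  qed
qed

section \<open>The standard figure\<close>

lemma off_grid_between:
  assumes "0 < t" "t < 1" "t \<noteq> 1 / 2"
  shows "2 * (t :: real) \<notin> \<int>"
proof
  assume "2 * t \<in> \<int>"
  then obtain k where k: "2 * t = of_int k" by (auto elim: Ints_cases)
  then have "0 < k" "k < 2" using assms by linarith+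
  then have "k = 1" by simp
  then have "2 * t = 1" using k by simp
  then show False using assms by simp
qed

lemma exists_off_grid_near:
  fixes t e :: real
  assumes "0 \<le> t" "t \<le> 1" "0 < e"
  obtains s where "0 < s" "s < 1" "s \<noteq> 1 / 2" "\<bar>s - t\<bar> < e"
proof -
  define l u where "l = max 0 (t - e)" and "u = min 1 (t + e)"
  have lu: "l < u" "0 \<le> l" "u \<le> 1" "t - e \<le> l" "u \<le> t + e"
    using assms by (auto simp: l_def u_def)
  define m where "m = (l + u) / 2"
  \<comment> \<open>If the midpoint happens to be \<open>1 / 2\<close>, the point halfway from it to
    \<open>u\<close> avoids that value.\<close>
  define s where "s = (if m = 1 / 2 then (m + u) / 2 else m)"
  have m: "l < m" "m < u" using lu by (auto simp: m_def)
  have "l < s" "s < u" "s \<noteq> 1 / 2" using m by (auto simp: s_def)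
  then show ?thesis using lu by (intro that[of s]) auto
qed

lemma standard_figure_cases:
  assumes "p \<in> standard_figure A"
  obtains (pos) i j t where "i < dim_row A" "j < dim_col A" "A $$ (i, j) = 1" "0 \<le> t" "t \<le> 1"
      "p = (real j + t, real (dim_row A) - real i - 1 + t)"
    | (neg) i j t where "i < dim_row A" "j < dim_col A" "A $$ (i, j) = - 1" "0 \<le> t" "t \<le> 1"
      "p = (real j + t, real (dim_row A) - real i - t)"
  using assms unfolding standard_figure_def cell_segment_def
  by (auto split: if_splits)

lemma standard_figure_posI:
  assumes "i < dim_row A" "j < dim_col A" "A $$ (i, j) = 1" "0 \<le> t" "t \<le> 1"
    "p = (real j + t, real (dim_row A) - real i - 1 + t)"
  shows "p \<in> standard_figure A"
proof -
  have "p \<in> cell_segment A i j" using assms by (auto simp: cell_segment_def)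
  then show ?thesis using assms(1,2) by (auto simp: standard_figure_def)
qed

lemma standard_figure_negI:
  assumes "i < dim_row A" "j < dim_col A" "A $$ (i, j) = - 1" "0 \<le> t" "t \<le> 1"
    "p = (real j + t, real (dim_row A) - real i - t)"
  shows "p \<in> standard_figure A"
proof -
  have "p \<in> cell_segment A i j" using assms by (auto simp: cell_segment_def)
  then show ?thesis using assms(1,2) by (auto simp: standard_figure_def)
qed

text \<open>The point slides along its own segment, so both coordinates move by the same small
  amount, and only the parameters 0, \<open>1 / 2\<close> and 1 are to be avoided.\<close>

lemma exists_off_grid_near_in_figure:
  assumes p: "p \<in> standard_figure A" and e: "0 < e"
  obtains q where "q \<in> standard_figure A" "off_grid q" "\<bar>fst q - fst p\<bar> < e" "\<bar>snd q - snd p\<bar> < e"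
proof -
  have int_add: "of_int k + 2 * s \<notin> \<int>" if "2 * s \<notin> \<int>" for k and s :: real
    using that Ints_diff[of "of_int k + 2 * s" "of_int k"] by auto
  have int_diff: "of_int k - 2 * s \<notin> \<int>" if "2 * s \<notin> \<int>" for k and s :: real
    using that Ints_diff[of "of_int k" "of_int k - 2 * s"] by auto
  from p show ?thesis
  proof (cases rule: standard_figure_cases)
    case (pos i j t)
    obtain s where s: "0 < s" "s < 1" "s \<noteq> 1 / 2" "\<bar>s - t\<bar> < e"
      using exists_off_grid_near[OF pos(4,5) e] .
    let ?q = "(real j + s, real (dim_row A) - real i - 1 + s)"
    have "2 * s \<notin> \<int>" using s by (intro off_grid_between)
    then have "off_grid ?q"
      using int_add[of s "2 * int j"] int_add[of s "2 * (int (dim_row A) - int i - 1)"]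
      by (simp add: off_grid_def algebra_simps)
    moreover have "?q \<in> standard_figure A"
      using pos s by (intro standard_figure_posI[of i A j s]) auto
    ultimately show ?thesis using s pos(6) by (intro that[of ?q]) auto
  next
    case (neg i j t)
    obtain s where s: "0 < s" "s < 1" "s \<noteq> 1 / 2" "\<bar>s - t\<bar> < e"
      using exists_off_grid_near[OF neg(4,5) e] .
    let ?q = "(real j + s, real (dim_row A) - real i - s)"
    have "2 * s \<notin> \<int>" using s by (intro off_grid_between)
    then have "off_grid ?q"
      using int_add[of s "2 * int j"] int_diff[of s "2 * (int (dim_row A) - int i)"]
      by (simp add: off_grid_def algebra_simps)
    moreover have "?q \<in> standard_figure A"
      using neg s by (intro standard_figure_negI[of i A j s]) auto
    ultimately show ?thesis using s neg(6) by (intro that[of ?q]) auto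
  qed
qed

lemma finite_separation:
  fixes k :: "'a \<Rightarrow> real"
  assumes "finite S" "inj_on k S"
  obtains e where "0 < e" "\<And>a b. a \<in> S \<Longrightarrow> b \<in> S \<Longrightarrow> a \<noteq> b \<Longrightarrow> e \<le> \<bar>k a - k b\<bar>"
proof
  \<comment> \<open>The entry 1 keeps the set nonempty when \<open>S\<close> has no two distinct
    points.\<close>
  let ?D = "insert 1 ((\<lambda>(a, b). \<bar>k a - k b\<bar>) ` {(a, b) \<in> S \<times> S. a \<noteq> b})"
  have fin: "finite ?D" using assms(1) by (auto intro: finite_subset[of _ "S \<times> S"])
  have "\<forall>d\<in>?D. 0 < d" using assms(2) by (auto simp: inj_on_def)
  then show "0 < Min ?D" using fin by (subst Min_gr_iff) auto
  show "Min ?D \<le> \<bar>k a - k b\<bar>" if "a \<in> S" "b \<in> S" "a \<noteq> b" for a b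
    using fin that by (intro Min_le) auto
qed

lemma perturbation_less_iff:
  fixes k :: "'a \<Rightarrow> real"
  assumes sep: "\<And>a b. a \<in> S \<Longrightarrow> b \<in> S \<Longrightarrow> a \<noteq> b \<Longrightarrow> e \<le> \<bar>k a - k b\<bar>"
    and near: "\<And>a. a \<in> S \<Longrightarrow> \<bar>k (\<phi> a) - k a\<bar> < e / 2"
    and "a \<in> S" "b \<in> S"
  shows "k (\<phi> a) < k (\<phi> b) \<longleftrightarrow> k a < k b"
proof (cases "a = b")
  case False
  then show ?thesis
    using sep[OF assms(3,4)] near[OF assms(3)] near[OF assms(4)] by linarith
qed simp

text \<open>Point sets in \<open>Geom\<close> may touch multiples of \<open>1 / 2\<close>. Moving
  each coordinate by less than half of the smallest gap keeps both orders.\<close>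

lemma pattern_in_config:
  assumes S: "general_position S" "S \<subseteq> standard_figure A"
  obtains T where "T \<in> config (standard_figure A) (card S)" "pattern T = pattern S"
proof -
  have fin: "finite S" "inj_on fst S" "inj_on snd S" using S by (auto simp: general_position_def)
  obtain e1 where e1: "0 < e1" "\<And>a b. a \<in> S \<Longrightarrow> b \<in> S \<Longrightarrow> a \<noteq> b \<Longrightarrow> e1 \<le> \<bar>fst a - fst b\<bar>"
    using finite_separation[OF fin(1,2)] by blast
  obtain e2 where e2: "0 < e2" "\<And>a b. a \<in> S \<Longrightarrow> b \<in> S \<Longrightarrow> a \<noteq> b \<Longrightarrow> e2 \<le> \<bar>snd a - snd b\<bar>"
    using finite_separation[OF fin(1,3)] by blast
  have "\<exists>q. q \<in> standard_figure A \<and> off_grid q \<and> \<bar>fst q - fst p\<bar> < e1 / 2 \<and> \<bar>snd q - snd p\<bar> < e2 / 2"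
    if "p \<in> S" for p
  proof -
    have "p \<in> standard_figure A" "0 < min e1 e2 / 2" using that S e1(1) e2(1) by auto
    then obtain q where "q \<in> standard_figure A" "off_grid q"
        "\<bar>fst q - fst p\<bar> < min e1 e2 / 2" "\<bar>snd q - snd p\<bar> < min e1 e2 / 2"
      by (rule exists_off_grid_near_in_figure)
    then show ?thesis by (intro exI[of _ q]) auto
  qed
  then obtain \<phi> where \<phi>: "\<And>p. p \<in> S \<Longrightarrow> \<phi> p \<in> standard_figure A \<and> off_grid (\<phi> p) \<and>
      \<bar>fst (\<phi> p) - fst p\<bar> < e1 / 2 \<and> \<bar>snd (\<phi> p) - snd p\<bar> < e2 / 2"
    by metis
  have x: "fst (\<phi> a) < fst (\<phi> b) \<longleftrightarrow> fst a < fst b" if "a \<in> S" "b \<in> S" for a b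
    using e1(2) \<phi> that by (intro perturbation_less_iff[of S e1]) auto
  have y: "snd (\<phi> a) < snd (\<phi> b) \<longleftrightarrow> snd a < snd b" if "a \<in> S" "b \<in> S" for a b
    using e2(2) \<phi> that by (intro perturbation_less_iff[of S e2]) auto
  have x_eq: "a = b" if "a \<in> S" "b \<in> S" "fst (\<phi> a) = fst (\<phi> b)" for a b
    using x[OF that(1,2)] x[OF that(2,1)] that fin(2) by (auto simp: inj_on_def)
  have y_eq: "a = b" if "a \<in> S" "b \<in> S" "snd (\<phi> a) = snd (\<phi> b)" for a b
    using y[OF that(1,2)] y[OF that(2,1)] that fin(3) by (auto simp: inj_on_def)
  have inj: "inj_on \<phi> S" using x_eq by (auto simp: inj_on_def)
  have gp: "general_position (\<phi> ` S)"
    unfolding general_position_def inj_on_def using fin(1) x_eq y_eq by blast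
  have "order_iso \<phi> S (\<phi> ` S)"
    unfolding order_iso_def bij_betw_def using x y inj by blast
  then have "pattern (\<phi> ` S) = pattern S"
    using order_iso_imp_pattern_eq[OF S(1) gp] by simp
  moreover have "\<phi> ` S \<in> config (standard_figure A) (card S)"
    using gp \<phi> card_image[OF inj] by (auto simp: config_def)
  ultimately show ?thesis by (intro that[of "\<phi> ` S"])
qed

lemma Geom_eq: "Geom A n = pattern ` config (standard_figure A) n"
proof (intro equalityI subsetI)
  fix p assume "p \<in> Geom A n"
  then obtain S where S: "p permutes {1..n}" "S \<subseteq> standard_figure A" "card S = n"
      "general_position S" "same_relative_order n p S"
    unfolding Geom_def general_position_def by blast
  then have "p = pattern S" using same_relative_order_iff[OF S(4)] by simp
  then show "p \<in> pattern ` config (standard_figure A) n"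
    using pattern_in_config[OF S(4,2)] S(3) by (metis image_eqI)
next
  fix p assume "p \<in> pattern ` config (standard_figure A) n"
  then obtain S where S: "S \<in> config (standard_figure A) n" "p = pattern S" by blast
  note S' = configD[OF S(1)]
  have "p permutes {1..n}" using pattern_permutes[OF S'(2)] S'(3) S(2) by simp
  moreover from this have "same_relative_order n p S"
    using same_relative_order_iff[OF S'(2)] S'(3) S(2) by simp
  ultimately show "p \<in> Geom A n" unfolding Geom_def using S' by blast
qed

lemma Geom_rc_eq:
  "Geom_rc A n = {p \<in> pattern ` config (standard_figure A) n. centrosymmetric_perm n p}"
  by (simp add: Geom_rc_def Geom_eq)

section \<open>The standard figure under spreading and rotation\<close>

lemma spread_unit:
  assumes "0 \<le> t" "t \<le> 1" "2 * t \<notin> \<int>"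
  shows "0 \<le> spread b t" "spread b t \<le> 1"
proof -
  have "t \<noteq> 1" using assms(3) by (metis Ints_numeral mult.right_neutral)
  then have "\<lfloor>2 * t\<rfloor> < 2" using assms by (simp add: floor_less_iff)
  moreover have "0 \<le> \<lfloor>2 * t\<rfloor>" using assms by simp
  moreover have "0 \<le> (\<lfloor>2 * t\<rfloor> + b) mod 2" "(\<lfloor>2 * t\<rfloor> + b) mod 2 < 2" by simp_all
  ultimately have "0 \<le> \<lfloor>2 * t\<rfloor> + (\<lfloor>2 * t\<rfloor> + b) mod 2" "\<lfloor>2 * t\<rfloor> + (\<lfloor>2 * t\<rfloor> + b) mod 2 \<le> 2"
    by linarith+
  then have "0 \<le> real_of_int (\<lfloor>2 * t\<rfloor> + (\<lfloor>2 * t\<rfloor> + b) mod 2)"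
    "real_of_int (\<lfloor>2 * t\<rfloor> + (\<lfloor>2 * t\<rfloor> + b) mod 2) \<le> 2"
    by linarith+
  then show "0 \<le> spread b t" "spread b t \<le> 1"
    unfolding spread_def using assms(1,2) by (simp_all only: field_simps)
qed

lemma off_grid_param:
  assumes "off_grid p" "fst p = real j + t"
  shows "2 * t \<notin> \<int>"
proof
  assume "2 * t \<in> \<int>"
  then have "of_int (2 * int j) + 2 * t \<in> \<int>" by (intro Ints_add) auto
  then show False using assms by (simp add: off_grid_def algebra_simps)
qed

text \<open>On segments of either slope the map acts through the parameter, replacing
  \<open>t\<close> by \<open>spread b t\<close>. The sum of the dimensions is a common bound for
  both coordinates.\<close>

lemma grid_figure_standard: "grid_figure (standard_figure A) (dim_row A + dim_col A)"
proof
  fix p assume p: "p \<in> standard_figure A"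
  then show "fst p \<in> {0..real (dim_row A + dim_col A)} \<and> snd p \<in> {0..real (dim_row A + dim_col A)}"
    by (cases rule: standard_figure_cases) auto
  fix b assume off: "off_grid p"
  from p show "spread2 b p \<in> standard_figure A"
  proof (cases rule: standard_figure_cases)
    case (pos i j t)
    have t: "2 * t \<notin> \<int>" using off_grid_param[OF off] pos(6) by simp
    have "spread2 b p = (real j + spread b t, real (dim_row A) - real i - 1 + spread b t)"
      using spread_int_add[of b "int j" t] spread_int_add[of b "int (dim_row A) - int i - 1" t]
      by (simp add: spread2_def pos(6))
    then show ?thesis
      using pos(1-3) spread_unit[OF pos(4,5) t] by (intro standard_figure_posI[of i A j "spread b t"])
  next
    case (neg i j t)
    have t: "2 * t \<notin> \<int>" using off_grid_param[OF off] neg(6) by simp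
    have "spread2 b p = (real j + spread b t, real (dim_row A) - real i - spread b t)"
      using spread_int_add[of b "int j" t] spread_int_add[of b "int (dim_row A) - int i" "- t"]
        spread_uminus[OF t]
      by (simp add: spread2_def neg(6))
    then show ?thesis
      using neg(1-3) spread_unit[OF neg(4,5) t] by (intro standard_figure_negI[of i A j "spread b t"])
  qed
qed

text \<open>Off-grid points lie in the interior of their cell, so integer parts identify it; rows
  are numbered from the top but heights from the bottom.\<close>

lemma off_grid_cell:
  assumes p: "p \<in> standard_figure A" and off: "off_grid p"
  obtains i j where "(i, j) \<in> cells A" "\<lfloor>fst p\<rfloor> = int j" "\<lfloor>snd p\<rfloor> = int (dim_row A) - 1 - int i"
    "\<lfloor>fst (rot (dim_col A) (dim_row A) p)\<rfloor> = int (dim_col A - 1 - j)"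
proof -
  have open_unit: "0 < t" "t < 1" if "0 \<le> t" "t \<le> 1" "2 * t \<notin> \<int>" for t :: real
  proof -
    have "t \<noteq> 0" "t \<noteq> 1" using that(3) by (auto simp: Ints_numeral)
    then show "0 < t" "t < 1" using that by auto
  qed
  from p show ?thesis
  proof (cases rule: standard_figure_cases)
    case (pos i j t)
    have t: "0 < t" "t < 1" using open_unit[OF pos(4,5)] off_grid_param[OF off] pos(6) by simp_all
    have "\<lfloor>real j + t\<rfloor> = int j" "\<lfloor>real (dim_row A) - real i - 1 + t\<rfloor> = int (dim_row A) - 1 - int i"
      "\<lfloor>real (dim_col A) - (real j + t)\<rfloor> = int (dim_col A - 1 - j)"
      using t pos(2) by (intro floor_unique; simp add: of_nat_diff)+
    then show ?thesis
      using pos(1-3) by (intro that[of i j]) (simp_all only: pos(6) cells_def rot_simps fst_conv snd_conv, simp)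
  next
    case (neg i j t)
    have t: "0 < t" "t < 1" using open_unit[OF neg(4,5)] off_grid_param[OF off] neg(6) by simp_all
    have "\<lfloor>real j + t\<rfloor> = int j" "\<lfloor>real (dim_row A) - real i - t\<rfloor> = int (dim_row A) - 1 - int i"
      "\<lfloor>real (dim_col A) - (real j + t)\<rfloor> = int (dim_col A - 1 - j)"
      using t neg(2) by (intro floor_unique; simp add: of_nat_diff)+
    then show ?thesis
      using neg(1-3) by (intro that[of i j]) (simp_all only: neg(6) cells_def rot_simps fst_conv snd_conv, simp)
  qed
qed

text \<open>The half-turn keeps slopes and reverses each segment, so the parameter becomes
  \<open>1 - t\<close> in the rotated cell.\<close>

lemma rot_in_standard_figure:
  assumes A: "centrosymmetric_mat A" and p: "p \<in> standard_figure A"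
  shows "rot (dim_col A) (dim_row A) p \<in> standard_figure A"
proof -
  have sym: "A $$ (dim_row A - 1 - i, dim_col A - 1 - j) = A $$ (i, j)"
    if "i < dim_row A" "j < dim_col A" for i j
    using A that unfolding centrosymmetric_mat_def by metis
  from p show ?thesis
  proof (cases rule: standard_figure_cases)
    case (pos i j t)
    show ?thesis
      using pos(1-5) sym[OF pos(1,2)]
      by (intro standard_figure_posI[of "dim_row A - 1 - i" A "dim_col A - 1 - j" "1 - t"])
        (simp_all add: pos(6) rot_def of_nat_diff)
  next
    case (neg i j t)
    show ?thesis
      using neg(1-5) sym[OF neg(1,2)]
      by (intro standard_figure_negI[of "dim_row A - 1 - i" A "dim_col A - 1 - j" "1 - t"])
        (simp_all add: neg(6) rot_def of_nat_diff)
  qed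
qed

text \<open>\<open>B\<close> is constant on the cells of each row and of each column, so it can be
  described by a set \<open>X\<close> of columns and equally by a set \<open>Y\<close> of
  rows.\<close>

lemma split_figure_standard:
  assumes A: "centrosymmetric_mat A" and moves: "rc_moves_components A"
  obtains X Y where
    "split_figure (standard_figure A) (dim_row A + dim_col A) (dim_col A) (dim_row A) X Y"
proof -
  from rc_moves_components_half[OF A moves] obtain B where
    rcB: "\<forall>v\<in>cells A. rc_cell A v \<in> B \<longleftrightarrow> v \<notin> B"
    and row: "\<forall>i j l. (i, j) \<in> cells A \<longrightarrow> (i, l) \<in> cells A \<longrightarrow> ((i, j) \<in> B \<longleftrightarrow> (i, l) \<in> B)"
    and col: "\<forall>i j k. (i, j) \<in> cells A \<longrightarrow> (k, j) \<in> cells A \<longrightarrow> ((i, j) \<in> B \<longleftrightarrow> (k, j) \<in> B)"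
    by (elim exE conjE)
  define X where "X = {int j |i j. (i, j) \<in> cells A \<and> (i, j) \<in> B}"
  define Y where "Y = {int (dim_row A) - 1 - int i |i j. (i, j) \<in> cells A \<and> (i, j) \<in> B}"
  have X: "int j \<in> X \<longleftrightarrow> (i, j) \<in> B" if "(i, j) \<in> cells A" for i j
    unfolding X_def mem_Collect_eq of_nat_eq_iff using that col by blast
  have Y: "int (dim_row A) - 1 - int i \<in> Y \<longleftrightarrow> (i, j) \<in> B" if "(i, j) \<in> cells A" for i j
  proof
    assume "int (dim_row A) - 1 - int i \<in> Y"
    then obtain i' j' where "int (dim_row A) - 1 - int i = int (dim_row A) - 1 - int i'"
        "(i', j') \<in> cells A" "(i', j') \<in> B"
      unfolding Y_def by blast
    moreover from this have "i' = i" by simp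
    ultimately show "(i, j) \<in> B" using that row by blast
  qed (use that in \<open>unfold Y_def, blast\<close>)
  interpret grid_figure "standard_figure A" "dim_row A + dim_col A" by (rule grid_figure_standard)
  have "split_figure (standard_figure A) (dim_row A + dim_col A) (dim_col A) (dim_row A) X Y"
  proof
    fix p assume p: "p \<in> standard_figure A"
    then show "rot (dim_col A) (dim_row A) p \<in> standard_figure A" by (rule rot_in_standard_figure[OF A])
    assume "off_grid p"
    with p obtain i j where ij: "(i, j) \<in> cells A" "\<lfloor>fst p\<rfloor> = int j"
        "\<lfloor>snd p\<rfloor> = int (dim_row A) - 1 - int i"
        "\<lfloor>fst (rot (dim_col A) (dim_row A) p)\<rfloor> = int (dim_col A - 1 - j)"
      by (rule off_grid_cell)
    show "\<lfloor>fst p\<rfloor> \<in> X \<longleftrightarrow> \<lfloor>snd p\<rfloor> \<in> Y"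
      unfolding ij(2,3) using X[OF ij(1)] Y[OF ij(1)] by simp
    have rc: "rc_cell A (i, j) = (dim_row A - 1 - i, dim_col A - 1 - j)" by (simp add: rc_cell_def)
    show "\<lfloor>fst (rot (dim_col A) (dim_row A) p)\<rfloor> \<in> X \<longleftrightarrow> \<lfloor>fst p\<rfloor> \<notin> X"
      unfolding ij(2,4) using X[OF ij(1)] X[OF rc_cell_in_cells[OF A ij(1), unfolded rc]]
        rcB[rule_format, OF ij(1), unfolded rc] by simp
  qed
  then show ?thesis by (rule that)
qed

text \<open>Joining with a single off-grid point raises the size by one.\<close>

lemma config_nonempty:
  assumes "standard_figure A \<noteq> {}"
  shows "config (standard_figure A) n \<noteq> {}"
proof (induction n)
  case 0
  have "{} \<in> config (standard_figure A) 0" by (simp add: config_def general_position_def)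
  then show ?case by blast
next
  case (Suc n)
  interpret grid_figure "standard_figure A" "dim_row A + dim_col A" by (rule grid_figure_standard)
  obtain p where "p \<in> standard_figure A" "(0 :: real) < 1" using assms by auto
  then obtain q where "q \<in> standard_figure A" "off_grid q"
      "\<bar>fst q - fst p\<bar> < 1" "\<bar>snd q - snd p\<bar> < 1"
    by (rule exists_off_grid_near_in_figure)
  then have "{q} \<in> config (standard_figure A) 1" by (simp add: config_def general_position_def)
  moreover obtain S where "S \<in> config (standard_figure A) n" using Suc by blast
  ultimately have "join S {q} \<in> config (standard_figure A) (1 + n)" by (intro join_config)
  then show ?case by auto
qed

lemma Geom_root_convergent:
  obtains L where "(\<lambda>n. ereal (root n (real (card (Geom A n))))) \<longlonglongrightarrow> L"
proof (cases "standard_figure A = {}")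
  case True
  \<comment> \<open>The empty permutation is counted at \<open>n = 0\<close>, but
    \<open>root 0\<close> is 0 by convention; for larger \<open>n\<close> the class is
    empty.\<close>
  have "root n (real (card (Geom A n))) = 0" for n
  proof (cases "n = 0")
    case False
    then have "Geom A n = {}" unfolding Geom_def True by auto
    then show ?thesis by simp
  qed simp
  then show ?thesis by (intro that[of 0]) (simp add: zero_ereal_def)
next
  case False
  interpret grid_figure "standard_figure A" "dim_row A + dim_col A" by (rule grid_figure_standard)
  let ?g = "\<lambda>n. card (code ` config (standard_figure A) n)"
  have "1 \<le> ?g n" for n
    using config_nonempty[OF False, of n] finite_codes[of n] by (simp add: Suc_le_eq card_gt_0_iff)
  then show ?thesis
    unfolding Geom_eq
    using supermultiplicative_root_convergent[of "\<lambda>n. card (pattern ` config (standard_figure A) n)" ?g,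
      OF card_patterns_le_codes card_codes_le_patterns card_codes_supermultiplicative] that
    unfolding Geom_eq by blast
qed

theorem theorem3p3:
  fixes A :: "int mat"
  assumes "elements_mat A \<subseteq> {0, 1, - 1}"
    and "centrosymmetric_mat A"
    and "even (dim_row A)"
    and "even (dim_col A)"
  shows "(is_forest (cell_edges A) \<longrightarrow> rc_moves_components A) \<and>
    (rc_moves_components A \<longrightarrow>
      liminf (\<lambda>n. ereal (root n (real (card (Geom_rc A (2 * n))))))
        \<ge> lim (\<lambda>n. ereal (root n (real (card (Geom A n))))))"
proof (intro conjI impI)
  assume "is_forest (cell_edges A)"
  then show "rc_moves_components A"
    by (rule forest_imp_rc_moves_components[OF assms(2-4)])
next
  assume "rc_moves_components A"
  with assms(2) obtain X Y where
    "split_figure (standard_figure A) (dim_row A + dim_col A) (dim_col A) (dim_row A) X Y"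
    by (rule split_figure_standard)
  then interpret split_figure "standard_figure A" "dim_row A + dim_col A" "dim_col A" "dim_row A" X Y .
  \<comment> \<open>\<open>lim\<close> is a definite description, so its value is available only
    once convergence is known.\<close>
  obtain L where L: "(\<lambda>n. ereal (root n (real (card (Geom A n))))) \<longlonglongrightarrow> L"
    by (rule Geom_root_convergent)
  have "L \<le> liminf (\<lambda>n. ereal (root n (real (card (Geom_rc A (2 * n))))))"
    using L by (rule le_liminf_root_if_poly_bound)
      (use card_patterns_le_centrosymmetric in \<open>unfold Geom_eq Geom_rc_eq\<close>)
  then show "liminf (\<lambda>n. ereal (root n (real (card (Geom_rc A (2 * n))))))
      \<ge> lim (\<lambda>n. ereal (root n (real (card (Geom A n)))))"
    using limI[OF L] by simp
qed

end
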